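(* There is a polynomial-time $2$-approximation algorithm for \textsc{L-Sided Pricing}; that is, a polynomial-time algorithm that, on every instance, outputs a feasible solution whose revenue is at least half of the maximum possible revenue.
   Context: An instance of \textsc{L-Sided Pricing} consists of a finite bipartite graph $G=(L\cup R,E)$ (parallel edges allowed, no loops; each edge $e=uv$ with $u\in L$, $v\in R$ is a customer interested in the bundle $\{u,v\}$), a capacity $\mu_w\in\mathbb Z_{\ge 0}\cup\{\infty\}$ for every vertex $w\in L\cup R$, and a budget $b_e\ge 0$ (a rational number given in the input) for every edge $e\in E$. A feasible solution is a pair $(p,F)$ where $p:L\cup R\to\mathbb R_{\ge0}$ satisfies $p(v)=0$ for every $v\in R$, and $F\subseteq E$ satisfies (i) $p(u)+p(v)\le b_e$ for every $e=uv\in F$ and (ii) every vertex $w$ is incident to at most $\mu_w$ edges of $F$. The revenue of $(p,F)$ is $\sum_{e=uv\in F}(p(u)+p(v))$, to be maximized. *)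

theory Defs
  imports
    Complex_Main
    "HOL-Library.Extended_Nat"
    "HOL-Library.Log_Nat"
    "HOL-Computational_Algebra.Polynomial"
begin

section \<open>Model of computation\<close>

text \<open>
  Algorithms are programs for a random access machine over the natural numbers, written in a
  structured while-language and charged by the logarithmic cost criterion. The memory consists of
  arrays, each of which is unbounded and has a name; a register is cell 0 of an array. A program
  mentions only finitely many names, so interleaving its arrays yields an ordinary RAM memory.
  Every number that is computed, read, written or used as an address is charged its bit length.
  Hence the running time is polynomially related to that of a Turing machine; in particular,
  a polynomial number of unit steps that produce numbers of exponential length is not polynomial
  time.
\<close>

type_synonym state = "string \<Rightarrow> nat \<Rightarrow> nat"

datatype aexp =
    Const nat
  | Read string aexp
  | Add aexp aexp
  | Sub aexp aexp
  | Mul aexp aexp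

datatype com =
    Skip
  | Write string aexp aexp
  | Seq com com
  | Cond aexp com com
  | While aexp com

definition bits :: "nat \<Rightarrow> nat" where
  "bits n = 1 + floorlog 2 n"

text \<open>Subtraction is truncated, so comparisons can be tested by \<open>Sub\<close>.\<close>

fun aval :: "aexp \<Rightarrow> state \<Rightarrow> nat" where
  "aval (Const n) s = n"
| "aval (Read x a) s = s x (aval a s)"
| "aval (Add a b) s = aval a s + aval b s"
| "aval (Sub a b) s = aval a s - aval b s"
| "aval (Mul a b) s = aval a s * aval b s"

fun acost :: "aexp \<Rightarrow> state \<Rightarrow> nat" where
  "acost (Const n) s = bits n"
| "acost (Read x a) s = acost a s + bits (s x (aval a s))"
| "acost (Add a b) s = acost a s + acost b s + bits (aval a s + aval b s)"
| "acost (Sub a b) s = acost a s + acost b s + bits (aval a s - aval b s)"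
| "acost (Mul a b) s = acost a s + acost b s + bits (aval a s * aval b s)"

text \<open>
  \<open>exec c s t s'\<close>: started in state \<open>s\<close>, the program \<open>c\<close> halts in state \<open>s'\<close> after time \<open>t\<close>.
  \<open>Write x i a\<close> stores the value of \<open>a\<close> in cell \<open>i\<close> of the array \<open>x\<close>; a test succeeds if its
  value is nonzero.
\<close>

inductive exec :: "com \<Rightarrow> state \<Rightarrow> nat \<Rightarrow> state \<Rightarrow> bool" where
  Skip: "exec Skip s 1 s"
| Write: "exec (Write x i a) s (acost i s + acost a s + 1) (s(x := (s x)(aval i s := aval a s)))"
| Seq: "exec c1 s1 t1 s2 \<Longrightarrow> exec c2 s2 t2 s3 \<Longrightarrow> exec (Seq c1 c2) s1 (t1 + t2) s3"
| CondTrue: "aval a s \<noteq> 0 \<Longrightarrow> exec c1 s t s' \<Longrightarrow> exec (Cond a c1 c2) s (acost a s + t + 1) s'"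
| CondFalse: "aval a s = 0 \<Longrightarrow> exec c2 s t s' \<Longrightarrow> exec (Cond a c1 c2) s (acost a s + t + 1) s'"
| WhileFalse: "aval a s = 0 \<Longrightarrow> exec (While a c) s (acost a s + 1) s"
| WhileTrue: "aval a s1 \<noteq> 0 \<Longrightarrow> exec c s1 t1 s2 \<Longrightarrow> exec (While a c) s2 t2 s3 \<Longrightarrow>
    exec (While a c) s1 (acost a s1 + t1 + t2 + 1) s3"

inductive_cases Skip_E: "exec Skip s t s'"
inductive_cases Write_E: "exec (Write x i a) s t s'"
inductive_cases Seq_E: "exec (Seq c1 c2) s t s'"
inductive_cases Cond_E: "exec (Cond a c1 c2) s t s'"
inductive_cases While_E: "exec (While a c) s t s'"

lemma exec_deterministic:
  "exec c s t s' \<Longrightarrow> exec c s u s'' \<Longrightarrow> u = t \<and> s'' = s'"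
proof (induction arbitrary: u s'' rule: exec.induct)
  case (Skip s)
  then show ?case by (auto elim: Skip_E)
next
  case (Write x i a s)
  then show ?case by (auto elim: Write_E)
next
  case (Seq c1 s1 t1 s2 c2 t2 s3)
  from Seq.prems obtain u1 r u2 where
    r: "exec c1 s1 u1 r" "exec c2 r u2 s''" and u: "u = u1 + u2"
    by (rule Seq_E)
  from Seq.IH(1)[OF r(1)] r(2) have "u1 = t1" "exec c2 s2 u2 s''" by simp_all
  with Seq.IH(2) u show ?case by simp
next
  case (CondTrue a s c1 t s' c2)
  from CondTrue.prems CondTrue.hyps(1) obtain u1 where "exec c1 s u1 s''" "u = acost a s + u1 + 1"
    by (auto elim: Cond_E)
  with CondTrue.IH show ?case by simp
next
  case (CondFalse a s c2 t s' c1)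
  from CondFalse.prems CondFalse.hyps(1) obtain u1 where "exec c2 s u1 s''" "u = acost a s + u1 + 1"
    by (auto elim: Cond_E)
  with CondFalse.IH show ?case by simp
next
  case (WhileFalse a s c)
  show ?case by (rule While_E[OF WhileFalse.prems]) (use WhileFalse.hyps in simp_all)
next
  case (WhileTrue a s1 c t1 s2 t2 s3)
  obtain u1 r u2 where
    r: "exec c s1 u1 r" "exec (While a c) r u2 s''" and u: "u = acost a s1 + u1 + u2 + 1"
    by (rule While_E[OF WhileTrue.prems]) (use WhileTrue.hyps(1) in auto)
  from WhileTrue.IH(1)[OF r(1)] r(2) have "u1 = t1" "exec (While a c) s2 u2 s''" by simp_all
  with WhileTrue.IH(2) u show ?case by simp
qed

definition initial_state :: "nat list \<Rightarrow> state" where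
  "initial_state xs = (\<lambda>x i.
     if x = ''input'' \<and> i < length xs then xs ! i
     else if x = ''input_length'' \<and> i = 0 then length xs
     else 0)"

definition output_of :: "state \<Rightarrow> nat list" where
  "output_of s = map (s ''output'') [0..<s ''output_length'' 0]"

definition computes :: "com \<Rightarrow> nat list \<Rightarrow> nat list \<Rightarrow> bool" where
  "computes c xs ys \<longleftrightarrow> (\<exists>t s. exec c (initial_state xs) t s \<and> output_of s = ys)"

definition input_size :: "nat list \<Rightarrow> nat" where
  "input_size xs = (\<Sum>x\<leftarrow>xs. bits x)"

definition polynomial_time :: "com \<Rightarrow> nat list set \<Rightarrow> bool" where
  "polynomial_time c X \<longleftrightarrow>
     (\<exists>q :: nat poly. \<forall>xs\<in>X. \<exists>t s. exec c (initial_state xs) t s \<and> t \<le> poly q (input_size xs))"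


section \<open>L-Sided Pricing\<close>

text \<open>
  Edges are objects of their own with a left and a right endpoint, so parallel edges may occur.
\<close>

record ('v, 'e) pricing =
  left_vertices :: "'v set"
  right_vertices :: "'v set"
  edges :: "'e set"
  left_end :: "'e \<Rightarrow> 'v"
  right_end :: "'e \<Rightarrow> 'v"
  capacity :: "'v \<Rightarrow> enat"
  budget :: "'e \<Rightarrow> rat"

definition pricing_instance :: "('v, 'e) pricing \<Rightarrow> bool" where
  "pricing_instance I \<longleftrightarrow>
     finite (left_vertices I) \<and> finite (right_vertices I) \<and> finite (edges I) \<and>
     left_vertices I \<inter> right_vertices I = {} \<and>
     (\<forall>e\<in>edges I. left_end I e \<in> left_vertices I \<and> right_end I e \<in> right_vertices I \<and>
        0 \<le> budget I e)"

definition feasible :: "('v, 'e) pricing \<Rightarrow> ('v \<Rightarrow> real) \<Rightarrow> 'e set \<Rightarrow> bool" where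
  "feasible I p F \<longleftrightarrow>
     (\<forall>w\<in>left_vertices I \<union> right_vertices I. 0 \<le> p w) \<and>
     (\<forall>v\<in>right_vertices I. p v = 0) \<and>
     F \<subseteq> edges I \<and>
     (\<forall>e\<in>F. p (left_end I e) + p (right_end I e) \<le> of_rat (budget I e)) \<and>
     (\<forall>w\<in>left_vertices I \<union> right_vertices I.
        enat (card {e \<in> F. left_end I e = w \<or> right_end I e = w}) \<le> capacity I w)"

definition revenue :: "('v, 'e) pricing \<Rightarrow> ('v \<Rightarrow> real) \<Rightarrow> 'e set \<Rightarrow> real" where
  "revenue I p F = (\<Sum>e\<in>F. p (left_end I e) + p (right_end I e))"


section \<open>Encoding\<close>

text \<open>
  Vertices are named by natural numbers. An instance is written down by listing the left vertices,
  the right vertices and the edges, each in an arbitrary order and without repetition. Rational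
  numbers are given by numerator and denominator in lowest terms.
\<close>

definition lists_instance ::
    "(nat, nat) pricing \<Rightarrow> nat list \<Rightarrow> nat list \<Rightarrow> nat list \<Rightarrow> bool" where
  "lists_instance I ls rs es \<longleftrightarrow>
     distinct ls \<and> set ls = left_vertices I \<and>
     distinct rs \<and> set rs = right_vertices I \<and>
     distinct es \<and> set es = edges I"

text \<open>Used for nonnegative rationals only.\<close>

definition encode_rat :: "rat \<Rightarrow> nat list" where
  "encode_rat r = [nat (fst (quotient_of r)), nat (snd (quotient_of r))]"

fun encode_capacity :: "enat \<Rightarrow> nat" where
  "encode_capacity (enat k) = Suc k"
| "encode_capacity \<infinity> = 0"

definition encode_instance ::
    "(nat, nat) pricing \<Rightarrow> nat list \<Rightarrow> nat list \<Rightarrow> nat list \<Rightarrow> nat list" where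
  "encode_instance I ls rs es =
     [length ls, length rs, length es]
     @ concat (map (\<lambda>w. [w, encode_capacity (capacity I w)]) (ls @ rs))
     @ concat (map (\<lambda>e. [left_end I e, right_end I e] @ encode_rat (budget I e)) es)"

text \<open>
  A solution is written as the prices of all vertices followed by the characteristic vector of
  \<open>F\<close>, in the order in which vertices and edges are listed in the input. Only rational prices can be
  output, whereas \<open>feasible\<close> admits arbitrary real prices.
\<close>

definition encode_solution ::
    "nat list \<Rightarrow> nat list \<Rightarrow> nat list \<Rightarrow> (nat \<Rightarrow> rat) \<Rightarrow> nat set \<Rightarrow> nat list" where
  "encode_solution ls rs es p F =
     concat (map (\<lambda>w. encode_rat (p w)) (ls @ rs)) @ map (\<lambda>e. if e \<in> F then 1 else 0) es"

definition instance_encodings :: "nat list set" where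
  "instance_encodings =
     {encode_instance I ls rs es | I ls rs es. pricing_instance I \<and> lists_instance I ls rs es}"

definition approximation_algorithm :: "real \<Rightarrow> com \<Rightarrow> bool" where
  "approximation_algorithm \<alpha> c \<longleftrightarrow>
     (\<forall>I ls rs es. pricing_instance I \<and> lists_instance I ls rs es \<longrightarrow>
        (\<exists>p F. computes c (encode_instance I ls rs es) (encode_solution ls rs es p F) \<and>
           feasible I (\<lambda>w. of_rat (p w)) F \<and>
           (\<forall>p' F'. feasible I p' F' \<longrightarrow> revenue I p' F' \<le> \<alpha> * revenue I (\<lambda>w. of_rat (p w)) F)))"

end

theory Submission
  imports Defs
begin

text \<open>
  Greedy in the spirit of submodular welfare maximization: serve the left vertices in any order; for
  each vertex \<open>u\<close>, try every budget of an edge at \<open>u\<close> as its price \<open>p\<close>, and keep the price that increases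
  the revenue most. The edges of \<open>u\<close> are placed in slots of their right ends, one at a time where
  the gain \<open>p - val f\<close> is largest, and evict the previous occupant, which paid \<open>val f\<close>; an exchange
  argument shows that this placement is optimal for the given price. Fix a rival solution and assign
  its edges injectively to slots of their right ends. When \<open>u\<close> is served, the gain is at least the sum of
  \<open>p\<^sub>u - val f\<close> over the rival's edges at \<open>u\<close> and their slots \<open>f\<close>. Slot values never decrease, so
  summing over \<open>u\<close> shows that the rival's revenue exceeds the revenue obtained by at most the total of
  the slot values, which is again the revenue obtained.

  The algorithm is a loop program without general multiplication, so that the lengths of all numbers
  grow at most linearly in the number of steps; its running time is then polynomial for syntactic
  reasons.
\<close>

section \<open>Loop programs\<close>

text \<open>Why budgets suffice as prices: at a left vertex \<open>u\<close> the smallest budget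
  among the edges sold there bounds the price of \<open>u\<close>, and charging exactly this budget
  sells the same edges. Why slots instead of a count per right vertex: the value that a rival's edge
  has to beat must be attached to an object fixed once and for all, before any eviction happens. An
  injection of the rival's edges into slots provides this, and it exists because a vertex has as
  many slots as capacity and degree allow. Naming slots by edges also keeps all arrays as short as
  the edge list, even for capacities that are infinite or exponentially large. Gains live in the
  natural numbers and are truncated at zero; this is harmless, since a truncated difference plus the
  subtracted value is still at least the price. Rational budgets are compared after scaling by a
  common factor; the factor cancels in the ratio, and the output copies numerator and denominator of
  a budget, so that no fraction is ever reduced.\<close>

datatype prog =
    Nop
  | Assign string aexp aexp
  | Then prog prog (infixr ";;" 60)
  | Branch aexp prog prog
  | Loop string nat prog

text \<open>The number of rounds is read once on entry, which makes \<open>run\<close> a total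
  function. The counter is incremented rather than set, to match the compiled code.\<close>

fun run :: "prog \<Rightarrow> state \<Rightarrow> state" where
  "run Nop s = s"
| "run (Assign x i a) s = s(x := (s x)(aval i s := aval a s))"
| "run (c ;; d) s = run d (run c s)"
| "run (Branch a c d) s = (if aval a s \<noteq> 0 then run c s else run d s)"
| "run (Loop x k c) s =
     ((\<lambda>s. let s' = run c s in s'(x := (s' x)(0 := Suc (s' x 0)))) ^^ s ''input'' k)
       (s(x := (s x)(0 := 0)))"

text \<open>The compiled test rereads bound and counter in every round. It agrees with
  \<open>run\<close> as long as the body writes neither, which \<open>tame\<close> demands.\<close>

fun compile :: "prog \<Rightarrow> com" where
  "compile Nop = Skip"
| "compile (Assign x i a) = Write x i a"
| "compile (c ;; d) = Seq (compile c) (compile d)"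
| "compile (Branch a c d) = Cond a (compile c) (compile d)"
| "compile (Loop x k c) =
     Seq (Write x (Const 0) (Const 0))
       (While (Sub (Read ''input'' (Const k)) (Read x (Const 0)))
         (Seq (compile c) (Write x (Const 0) (Add (Read x (Const 0)) (Const 1)))))"

fun writes :: "prog \<Rightarrow> string set" where
  "writes Nop = {}"
| "writes (Assign x i a) = {x}"
| "writes (c ;; d) = writes c \<union> writes d"
| "writes (Branch a c d) = writes c \<union> writes d"
| "writes (Loop x k c) = insert x (writes c)"

text \<open>One factor of every product is a constant or an input cell, so that a single step lengthens
  the numbers in the memory by at most a constant plus the length of the longest input number.\<close>

fun small_products :: "aexp \<Rightarrow> bool" where
  "small_products (Const n) \<longleftrightarrow> True"
| "small_products (Read x a) \<longleftrightarrow> small_products a"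
| "small_products (Add a b) \<longleftrightarrow> small_products a \<and> small_products b"
| "small_products (Sub a b) \<longleftrightarrow> small_products a \<and> small_products b"
| "small_products (Mul a (Const n)) \<longleftrightarrow> small_products a"
| "small_products (Mul a (Read x b)) \<longleftrightarrow> x = ''input'' \<and> small_products a \<and> small_products b"
| "small_products (Mul a b) \<longleftrightarrow> False"

text \<open>Only the first three input cells, which hold the three counts of an instance, bound loops.\<close>

fun tame :: "prog \<Rightarrow> bool" where
  "tame Nop \<longleftrightarrow> True"
| "tame (Assign x i a) \<longleftrightarrow> x \<noteq> ''input'' \<and> small_products i \<and> small_products a"
| "tame (c ;; d) \<longleftrightarrow> tame c \<and> tame d"
| "tame (Branch a c d) \<longleftrightarrow> small_products a \<and> tame c \<and> tame d"
| "tame (Loop x k c) \<longleftrightarrow> x \<noteq> ''input'' \<and> x \<notin> writes c \<and> k < 3 \<and> tame c"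

lemma tame_writes: "tame c \<Longrightarrow> ''input'' \<notin> writes c"
  by (induction c) auto

lemma run_frame: "y \<notin> writes c \<Longrightarrow> run c s y = s y"
proof (induction c arbitrary: s)
  case (Loop x k c)
  have "((\<lambda>s. let s' = run c s in s'(x := (s' x)(0 := Suc (s' x 0)))) ^^ n) r y = r y" for n r
    using Loop by (induction n) (auto simp: Let_def)
  then show ?case using Loop.prems by simp
qed auto

text \<open>The body does not write the counter, so after \<open>i\<close> rounds the counter holds
  \<open>i\<close>. The premise on \<open>y\<close> hands every array that the loop leaves alone to
  the step case, so that invariants need not mention it.\<close>

lemma run_Loop_induct [case_names fresh bound init step]:
  assumes x: "x \<notin> writes c" and n: "s ''input'' k = n"
    and init: "I 0 (s(x := (s x)(0 := 0)))"
    and step: "\<And>i t. i < n \<Longrightarrow> I i t \<Longrightarrow> t x 0 = i \<Longrightarrow> (\<And>y. y \<notin> insert x (writes c) \<Longrightarrow> t y = s y)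
      \<Longrightarrow> I (Suc i) ((run c t)(x := (run c t x)(0 := Suc i)))"
  shows "I n (run (Loop x k c) s)"
proof -
  let ?f = "\<lambda>s. let s' = run c s in s'(x := (s' x)(0 := Suc (s' x 0)))"
  let ?s = "s(x := (s x)(0 := 0))"
  have "I i ((?f ^^ i) ?s) \<and> (?f ^^ i) ?s x 0 = i \<and>
      (\<forall>y. y \<notin> insert x (writes c) \<longrightarrow> (?f ^^ i) ?s y = s y)" if "i \<le> n" for i
    using that
  proof (induction i)
    case 0
    have "(?f ^^ 0) ?s = ?s" by simp
    then show ?case using init by (intro conjI allI impI) (simp_all only:, simp_all)
  next
    case (Suc i)
    define t where "t = (?f ^^ i) ?s"
    have t: "I i t" "t x 0 = i" "\<And>y. y \<notin> insert x (writes c) \<Longrightarrow> t y = s y"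
      using Suc.IH[OF Suc_leD[OF Suc.prems]] unfolding t_def by blast+
    have "(?f ^^ Suc i) ?s = ?f t" by (simp add: t_def)
    also have "\<dots> = (run c t)(x := (run c t x)(0 := Suc i))"
      using t(2) run_frame[OF x, of t] by (simp add: Let_def)
    finally have f: "(?f ^^ Suc i) ?s = (run c t)(x := (run c t x)(0 := Suc i))" .
    show ?case
      unfolding f using step[OF _ t] t(3) Suc.prems run_frame[of _ c t]
      by (metis Suc_le_lessD fun_upd_apply insertCI)
  qed
  then show ?thesis using n by simp
qed

section \<open>Time and growth of numbers in loop programs\<close>

fun asize :: "aexp \<Rightarrow> nat" where
  "asize (Const n) = Suc n"
| "asize (Read x a) = Suc (asize a)"
| "asize (Add a b) = Suc (asize a + asize b)"
| "asize (Sub a b) = Suc (asize a + asize b)"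
| "asize (Mul a b) = Suc (asize a + asize b)"

text \<open>Loops are charged \<open>N\<close> rounds, and both branches of a test are added. In a
  loop the test has size \<open>k + 5\<close>, the increment weighs 7 and the initialization 3;
  \<open>k + 15\<close> leaves room for these and for the unit steps. In \<open>asize\<close> a
  constant counts with its value, so that \<open>n < 2 ^ n\<close> is enough to bound it.\<close>

fun work :: "nat \<Rightarrow> prog \<Rightarrow> nat" where
  "work N Nop = 1"
| "work N (Assign x i a) = asize i + asize a + 1"
| "work N (c ;; d) = work N c + work N d"
| "work N (Branch a c d) = asize a + work N c + work N d + 1"
| "work N (Loop x k c) = k + 15 + N * (work N c + k + 15)"

lemma bits_le: "n < 2 ^ K \<Longrightarrow> bits n \<le> Suc K"
  unfolding bits_def by (simp add: floorlog_le_iff)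

text \<open>Each unit of size adds at most \<open>Suc B\<close> bits: a sum adds one bit, a product
  with an input cell \<open>B\<close> bits, and a product with the constant \<open>n\<close>, whose
  size is \<open>Suc n\<close>, adds \<open>n\<close> bits.\<close>

lemma aval_bound:
  assumes "small_products a" "\<And>x i. s x i < 2 ^ K" "\<And>i. s ''input'' i < 2 ^ B"
  shows "aval a s < 2 ^ (K + asize a * Suc B)"
  using assms(1)
proof (induction a rule: small_products.induct)
  case (1 n)
  have "n < 2 ^ n" by (rule less_exp)
  also have "(2::nat) ^ n \<le> 2 ^ (K + Suc n * Suc B)" by (rule power_increasing) auto
  finally show ?case by simp
next
  case (2 x a)
  have "s x (aval a s) < 2 ^ K" by (rule assms)
  also have "(2::nat) ^ K \<le> 2 ^ (K + asize (Read x a) * Suc B)" by (rule power_increasing) auto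
  finally show ?case by simp
next
  case (3 a b)
  let ?e = "K + (asize a + asize b) * Suc B"
  have "aval a s < 2 ^ (K + asize a * Suc B)" "aval b s < 2 ^ (K + asize b * Suc B)"
    using 3 by auto
  moreover have "(2::nat) ^ (K + asize a * Suc B) \<le> 2 ^ ?e" "(2::nat) ^ (K + asize b * Suc B) \<le> 2 ^ ?e"
    by (intro power_increasing add_left_mono mult_le_mono1; simp)+
  ultimately have "aval (Add a b) s < 2 * 2 ^ ?e" unfolding aval.simps by linarith
  also have "\<dots> = 2 ^ Suc ?e" by simp
  also have "\<dots> \<le> 2 ^ (K + asize (Add a b) * Suc B)" by (rule power_increasing) auto
  finally show ?case .
next
  case (4 a b)
  have "aval (Sub a b) s \<le> aval a s" by simp
  also have "\<dots> < 2 ^ (K + asize a * Suc B)" using 4 by auto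
  also have "(2::nat) ^ (K + asize a * Suc B) \<le> 2 ^ (K + asize (Sub a b) * Suc B)"
    by (intro power_increasing add_left_mono mult_le_mono1; simp)
  finally show ?case .
next
  case (5 a n)
  have "aval a s * n \<le> aval a s * 2 ^ n" by (simp add: less_exp less_imp_le)
  also have "\<dots> < 2 ^ (K + asize a * Suc B) * 2 ^ n" using 5 by auto
  also have "\<dots> = 2 ^ (K + asize a * Suc B + n)" by (simp add: power_add)
  also have "\<dots> \<le> 2 ^ (K + asize (Mul a (Const n)) * Suc B)"
    by (rule power_increasing) (simp_all add: algebra_simps)
  finally show ?case by simp
next
  case (6 a x b)
  have "aval (Mul a (Read x b)) s < 2 ^ (K + asize a * Suc B) * 2 ^ B"
    using 6 assms(3) by (auto intro!: mult_strict_mono)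
  also have "\<dots> = 2 ^ (K + asize a * Suc B + B)" by (simp add: power_add)
  also have "\<dots> \<le> 2 ^ (K + asize (Mul a (Read x b)) * Suc B)"
    by (rule power_increasing) (simp_all add: algebra_simps)
  finally show ?case .
qed auto

lemma acost_bound:
  assumes "small_products a" "\<And>x i. s x i < 2 ^ K" "\<And>i. s ''input'' i < 2 ^ B"
  shows "acost a s \<le> asize a * Suc (K + asize a * Suc B)"
proof -
  \<comment> \<open>The outer size \<open>A\<close> fixes one rate for all subexpressions, so that
    their costs simply add up.\<close>
  have *: "acost a s \<le> asize a * Suc (K + A * Suc B)"
    if "asize a \<le> A" "small_products a" for a A
    using that
  proof (induction a)
    case (Const n)
    have "bits n \<le> Suc n" by (intro bits_le less_exp)
    then show ?case by simp
  next
    case (Read x a)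
    have "bits (s x (aval a s)) \<le> Suc K" by (intro bits_le assms)
    then show ?case using Read by simp
  next
    case (Add a b)
    have "bits (aval (Add a b) s) \<le> Suc (K + asize (Add a b) * Suc B)"
      by (intro bits_le aval_bound assms(2,3) Add.prems(2))
    also have "\<dots> \<le> Suc (K + A * Suc B)" using Add.prems(1)
      by (intro iffD2[OF Suc_le_mono] add_left_mono mult_le_mono1)
    finally show ?case using Add by (simp add: algebra_simps)
  next
    case (Sub a b)
    have "bits (aval (Sub a b) s) \<le> Suc (K + asize (Sub a b) * Suc B)"
      by (intro bits_le aval_bound assms(2,3) Sub.prems(2))
    also have "\<dots> \<le> Suc (K + A * Suc B)" using Sub.prems(1)
      by (intro iffD2[OF Suc_le_mono] add_left_mono mult_le_mono1)
    finally show ?case using Sub by (simp add: algebra_simps)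
  next
    case (Mul a b)
    have m: "small_products a" "small_products b"
      using Mul.prems(2) by (cases b; simp)+
    have "bits (aval (Mul a b) s) \<le> Suc (K + asize (Mul a b) * Suc B)"
      by (intro bits_le aval_bound assms(2,3) Mul.prems(2))
    also have "\<dots> \<le> Suc (K + A * Suc B)" using Mul.prems(1)
      by (intro iffD2[OF Suc_le_mono] add_left_mono mult_le_mono1)
    finally show ?case using Mul m by (simp add: algebra_simps)
  qed
  show ?thesis using * assms(1) by blast
qed

text \<open>\<open>K\<close> bounds the length of all cells and grows during a run; \<open>B\<close>
  and \<open>N\<close> bound the input, which is never written, and stay fixed.\<close>

definition bounded_state :: "nat \<Rightarrow> nat \<Rightarrow> nat \<Rightarrow> state \<Rightarrow> bool" where
  "bounded_state N B K s \<longleftrightarrow>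
     (\<forall>x i. s x i < 2 ^ K) \<and> (\<forall>i. s ''input'' i < 2 ^ B) \<and> (\<forall>k<3. s ''input'' k \<le> N)"

text \<open>One weight \<open>w\<close> bounds both the time and the growth of numbers. Lengths grow
  by the additive amount \<open>w * Suc B\<close>, so the weights of consecutive programs add up and
  a loop only multiplies by its number of rounds.\<close>

definition costs :: "nat \<Rightarrow> nat \<Rightarrow> nat \<Rightarrow> com \<Rightarrow> (state \<Rightarrow> state) \<Rightarrow> bool" where
  "costs N B w c f \<longleftrightarrow> (\<forall>K s. bounded_state N B K s \<longrightarrow>
     bounded_state N B (K + w * Suc B) (f s) \<and>
     (\<exists>t. exec c s t (f s) \<and> t \<le> w * (3 + K + w * Suc B)))"

lemma bounded_state_mono: "bounded_state N B K s \<Longrightarrow> K \<le> K' \<Longrightarrow> bounded_state N B K' s"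
  unfolding bounded_state_def by (meson less_le_trans one_le_numeral power_increasing)

lemma cost_rate_mono: "v \<le> w \<Longrightarrow> Suc (K + v * Suc B) \<le> 3 + K + w * Suc B"
  using mult_le_mono1[of v w "Suc B"] by linarith

lemma costs_Write:
  assumes "x \<noteq> ''input''" "small_products i" "small_products a" "asize i + asize a + 1 \<le> w"
  shows "costs N B w (Write x i a) (\<lambda>s. s(x := (s x)(aval i s := aval a s)))"
  unfolding costs_def
proof (intro allI impI conjI)
  fix K s
  assume b: "bounded_state N B K s"
  then have s: "\<And>x i. s x i < 2 ^ K" "\<And>i. s ''input'' i < 2 ^ B"
    by (auto simp: bounded_state_def)
  have "aval a s < 2 ^ (K + asize a * Suc B)" by (rule aval_bound) (use assms s in auto)
  also have "(2::nat) ^ (K + asize a * Suc B) \<le> 2 ^ (K + w * Suc B)"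
    using assms(4) by (auto intro!: power_increasing mult_le_mono simp del: mult_Suc_right)
  finally have "aval a s < 2 ^ (K + w * Suc B)" .
  moreover have "bounded_state N B (K + w * Suc B) s" using b by (rule bounded_state_mono) simp
  ultimately show "bounded_state N B (K + w * Suc B) (s(x := (s x)(aval i s := aval a s)))"
    using assms(1) by (auto simp: bounded_state_def)
  have "acost i s \<le> asize i * Suc (K + asize i * Suc B)" by (rule acost_bound) (use assms s in auto)
  also have "\<dots> \<le> asize i * (3 + K + w * Suc B)"
    using assms(4) by (intro mult_le_mono2 cost_rate_mono) simp
  finally have ci: "acost i s \<le> asize i * (3 + K + w * Suc B)" .
  have "acost a s \<le> asize a * Suc (K + asize a * Suc B)" by (rule acost_bound) (use assms s in auto)
  also have "\<dots> \<le> asize a * (3 + K + w * Suc B)"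
    using assms(4) by (intro mult_le_mono2 cost_rate_mono) simp
  finally have ca: "acost a s \<le> asize a * (3 + K + w * Suc B)" .
  have "acost i s + acost a s + 1 \<le> (asize i + asize a + 1) * (3 + K + w * Suc B)"
    using ci ca by (simp add: algebra_simps)
  also have "\<dots> \<le> w * (3 + K + w * Suc B)" using assms(4) by (intro mult_le_mono) auto
  finally show "\<exists>t. exec (Write x i a) s t (s(x := (s x)(aval i s := aval a s))) \<and>
      t \<le> w * (3 + K + w * Suc B)"
    using exec.Write by blast
qed

lemma costs_Seq:
  assumes "costs N B v c f" "costs N B w d g"
  shows "costs N B (v + w) (Seq c d) (\<lambda>s. g (f s))"
  unfolding costs_def
proof (intro allI impI)
  fix K s
  assume "bounded_state N B K s"
  with assms(1) obtain t where b: "bounded_state N B (K + v * Suc B) (f s)"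
    and t: "exec c s t (f s)" "t \<le> v * (3 + K + v * Suc B)"
    unfolding costs_def by blast
  from b assms(2) obtain t' where b': "bounded_state N B (K + v * Suc B + w * Suc B) (g (f s))"
    and t': "exec d (f s) t' (g (f s))" "t' \<le> w * (3 + (K + v * Suc B) + w * Suc B)"
    unfolding costs_def by blast
  have "exec (Seq c d) s (t + t') (g (f s))" using t t' by (blast intro: exec.Seq)
  moreover have "t + t' \<le> (v + w) * (3 + K + (v + w) * Suc B)"
    using t(2) t'(2) by (simp add: algebra_simps)
  ultimately show "bounded_state N B (K + (v + w) * Suc B) (g (f s)) \<and>
      (\<exists>t. exec (Seq c d) s t (g (f s)) \<and> t \<le> (v + w) * (3 + K + (v + w) * Suc B))"
    using b' by (auto simp: algebra_simps)
qed

lemma costs_compile: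
  assumes "tame c"
  shows "costs N B (work N c) (compile c) (run c)"
  using assms
proof (induction c)
  case Nop
  have "costs N B 1 Skip (\<lambda>s. s)"
    unfolding costs_def
  proof (intro allI impI conjI)
    fix K s
    assume "bounded_state N B K s"
    then show "bounded_state N B (K + 1 * Suc B) s" by (rule bounded_state_mono) simp
    show "\<exists>t. exec Skip s t s \<and> t \<le> 1 * (3 + K + 1 * Suc B)"
      using exec.Skip by fastforce
  qed
  moreover have "run Nop = (\<lambda>s. s)" by (simp add: fun_eq_iff)
  ultimately show ?case by simp
next
  case (Assign x i a)
  have "run (Assign x i a) = (\<lambda>s. s(x := (s x)(aval i s := aval a s)))"
    by (rule ext) simp
  moreover have "x \<noteq> ''input''" "small_products i" "small_products a" using Assign by auto
  ultimately show ?case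
    using costs_Write[OF _ _ _ order_refl] by (simp only: compile.simps work.simps)
next
  case (Then c d)
  then show ?case using costs_Seq by simp
next
  case (Branch a c d)
  show ?case
    unfolding costs_def
  proof (intro allI impI)
    fix K s
    assume b: "bounded_state N B K s"
    let ?w = "work N (Branch a c d)"
    let ?v = "if aval a s \<noteq> 0 then work N c else work N d"
    from b have s: "\<And>x i. s x i < 2 ^ K" "\<And>i. s ''input'' i < 2 ^ B"
      by (auto simp: bounded_state_def)
    have IH: "costs N B (work N c) (compile c) (run c)" "costs N B (work N d) (compile d) (run d)"
      using Branch by auto
    obtain t where t: "bounded_state N B (K + ?v * Suc B) (run (Branch a c d) s)"
      "exec (if aval a s \<noteq> 0 then compile c else compile d) s t (run (Branch a c d) s)"
      "t \<le> ?v * (3 + K + ?v * Suc B)"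
      using IH b unfolding costs_def by (cases "aval a s = 0") force+
    have "acost a s \<le> asize a * Suc (K + asize a * Suc B)" using Branch.prems by (intro acost_bound s) auto
    also have "\<dots> \<le> asize a * (3 + K + ?w * Suc B)"
      by (intro mult_le_mono2 cost_rate_mono) simp
    finally have ca: "acost a s \<le> asize a * (3 + K + ?w * Suc B)" .
    have "t \<le> ?v * (3 + K + ?w * Suc B)"
      by (rule order_trans[OF t(3)]) (intro mult_le_mono add_left_mono, auto)
    with ca have "acost a s + t + 1 \<le> (asize a + ?v + 1) * (3 + K + ?w * Suc B)"
      by (simp add: add_mult_distrib)
    also have "\<dots> \<le> ?w * (3 + K + ?w * Suc B)" by (intro mult_le_mono) auto
    finally have "acost a s + t + 1 \<le> ?w * (3 + K + ?w * Suc B)" .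
    moreover have "exec (compile (Branch a c d)) s (acost a s + t + 1) (run (Branch a c d) s)"
      using t(2) exec.CondTrue[of a s "compile c" t _ "compile d"]
        exec.CondFalse[of a s "compile d" t _ "compile c"]
      by (cases "aval a s = 0") simp_all
    moreover have "bounded_state N B (K + ?w * Suc B) (run (Branch a c d) s)"
      by (rule bounded_state_mono[OF t(1)]) (intro add_left_mono mult_le_mono, auto)
    ultimately show "bounded_state N B (K + ?w * Suc B) (run (Branch a c d) s) \<and>
      (\<exists>t. exec (compile (Branch a c d)) s t (run (Branch a c d) s) \<and> t \<le> ?w * (3 + K + ?w * Suc B))"
      by blast
  qed
next
  case (Loop x k c)
  then have x: "x \<noteq> ''input''" "x \<notin> writes c" "k < 3" "tame c" by auto
  let ?inc = "\<lambda>s :: state. s(x := (s x)(0 := Suc (s x 0)))"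
  let ?f = "\<lambda>s. ?inc (run c s)"
  let ?test = "Sub (Read ''input'' (Const k)) (Read x (Const 0))"
  let ?body = "Seq (compile c) (Write x (Const 0) (Add (Read x (Const 0)) (Const 1)))"
  let ?v = "work N c + 7"
  let ?u = "work N c + k + 15"
  have "costs N B 7 (Write x (Const 0) (Add (Read x (Const 0)) (Const 1))) ?inc"
    using costs_Write[OF x(1), of "Const 0" "Add (Read x (Const 0)) (Const 1)" 7 N B] by simp
  then have body: "costs N B ?v ?body ?f"
    using costs_Seq[OF Loop.IH[OF x(4)]] by blast
  \<comment> \<open>The induction is on the rounds still to go, with \<open>K\<close> arbitrary
    because every round raises it by \<open>?u * Suc B\<close>. The part \<open>k + 12\<close> pays
    for the final, failing test.\<close>
  have loop: "bounded_state N B (K + (k + 12 + n * ?u) * Suc B) ((?f ^^ n) s) \<and>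
      (\<exists>t. exec (While ?test ?body) s t ((?f ^^ n) s) \<and>
        t \<le> (k + 12 + n * ?u) * (3 + K + (k + 12 + n * ?u) * Suc B))"
    if "bounded_state N B K s" "s ''input'' k = s x 0 + n" for n K s
    using that
  proof (induction n arbitrary: K s)
    case 0
    from 0(1) have s: "\<And>x i. s x i < 2 ^ K" "\<And>i. s ''input'' i < 2 ^ B"
      by (auto simp: bounded_state_def)
    have "acost ?test s \<le> asize ?test * Suc (K + asize ?test * Suc B)"
      by (intro acost_bound s) auto
    then have "acost ?test s + 1 \<le> (k + 12) * (3 + K + (k + 12) * Suc B)"
      by (simp add: algebra_simps)
    moreover have "exec (While ?test ?body) s (acost ?test s + 1) s"
      using 0 by (intro exec.WhileFalse) simp
    moreover have "bounded_state N B (K + (k + 12) * Suc B) s"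
      by (rule bounded_state_mono[OF 0(1)]) simp
    ultimately show ?case by auto
  next
    case (Suc n)
    from Suc.prems(1) have s: "\<And>x i. s x i < 2 ^ K" "\<And>i. s ''input'' i < 2 ^ B"
      by (auto simp: bounded_state_def)
    obtain t where t: "bounded_state N B (K + ?v * Suc B) (?f s)"
      "exec ?body s t (?f s)" "t \<le> ?v * (3 + K + ?v * Suc B)"
      using body Suc.prems(1) unfolding costs_def by blast
    have "bounded_state N B (K + ?u * Suc B) (?f s)"
      by (rule bounded_state_mono[OF t(1)]) (simp add: algebra_simps)
    moreover have "?f s ''input'' k = ?f s x 0 + n"
      using Suc.prems(2) x tame_writes[OF x(4)] by (simp add: run_frame)
    ultimately obtain t' where
      b: "bounded_state N B (K + ?u * Suc B + (k + 12 + n * ?u) * Suc B) ((?f ^^ n) (?f s))"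
      and t': "exec (While ?test ?body) (?f s) t' ((?f ^^ n) (?f s))"
        "t' \<le> (k + 12 + n * ?u) * (3 + (K + ?u * Suc B) + (k + 12 + n * ?u) * Suc B)"
      using Suc.IH by blast
    have iter: "(?f ^^ n) (?f s) = (?f ^^ Suc n) s" by (simp only: funpow_Suc_right comp_apply)
    have test: "acost ?test s \<le> asize ?test * Suc (K + asize ?test * Suc B)"
      by (intro acost_bound s) auto
    have "exec (While ?test ?body) s (acost ?test s + t + t' + 1) ((?f ^^ n) (?f s))"
      using Suc.prems(2) by (intro exec.WhileTrue[OF _ t(2) t'(1)]) simp
    moreover have "acost ?test s + t + t' + 1 \<le>
        (k + 12 + Suc n * ?u) * (3 + K + (k + 12 + Suc n * ?u) * Suc B)"
    proof -
      let ?X = "3 + K + (k + 12 + Suc n * ?u) * Suc B"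
      have "asize ?test = k + 5" by simp
      then have "asize ?test * Suc (K + asize ?test * Suc B) \<le> (k + 5) * ?X"
        by (simp only:) (intro mult_le_mono2 cost_rate_mono, simp)
      with test have 1: "acost ?test s \<le> (k + 5) * ?X" by (rule order_trans)
      have "?v * (3 + K + ?v * Suc B) \<le> ?v * ?X"
        by (intro mult_le_mono) (auto simp: algebra_simps)
      with t(3) have 2: "t \<le> ?v * ?X" by (rule order_trans)
      have "3 + (K + ?u * Suc B) + (k + 12 + n * ?u) * Suc B = ?X"
        by (simp add: algebra_simps)
      with t'(2) have "t' \<le> (k + 12 + n * ?u) * ?X" by (simp only:)
      with 1 2 have "acost ?test s + t + t' + 1 \<le>
          (k + 5) * ?X + ?v * ?X + (k + 12 + n * ?u) * ?X + 1"
        by (intro add_mono order_refl)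
      also have "\<dots> \<le> (k + 12 + Suc n * ?u) * ?X" by (simp add: algebra_simps)
      finally show ?thesis .
    qed
    moreover have "K + ?u * Suc B + (k + 12 + n * ?u) * Suc B = K + (k + 12 + Suc n * ?u) * Suc B"
      by (simp add: algebra_simps)
    ultimately show ?case using b unfolding iter by (simp only:) blast
  qed
  define g where "g s = (?f ^^ (s ''input'' k - s x 0)) s" for s
  define h :: "state \<Rightarrow> state" where "h s = s(x := (s x)(0 := 0))" for s
  have init: "costs N B 3 (Write x (Const 0) (Const 0)) h"
    using costs_Write[OF x(1), of "Const 0" "Const 0" 3 N B] by (simp add: h_def[abs_def])
  show ?case
    unfolding costs_def
  proof (intro allI impI)
    fix K s
    let ?w = "work N (Loop x k c)"
    assume b: "bounded_state N B K s"
    obtain t where t: "bounded_state N B (K + 3 * Suc B) (h s)"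
      "exec (Write x (Const 0) (Const 0)) s t (h s)" "t \<le> 3 * (3 + K + 3 * Suc B)"
      using init b unfolding costs_def by blast
    have hs: "h s ''input'' k = h s x 0 + s ''input'' k" using x by (simp add: h_def)
    let ?n = "s ''input'' k" let ?l = "k + 12 + ?n * ?u"
    have n: "?n \<le> N" using b x(3) by (auto simp: bounded_state_def)
    obtain t' where t': "bounded_state N B (K + 3 * Suc B + ?l * Suc B) ((?f ^^ ?n) (h s))"
      "exec (While ?test ?body) (h s) t' ((?f ^^ ?n) (h s))"
      "t' \<le> ?l * (3 + (K + 3 * Suc B) + ?l * Suc B)"
      using loop[OF t(1) hs] by blast
    have r: "run (Loop x k c) s = (?f ^^ ?n) (h s)" by (simp add: h_def Let_def)
    have l: "?l + 3 \<le> ?w" using n by (simp add: add_mult_distrib2[symmetric])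
    have "3 + (K + 3 * Suc B) + ?l * Suc B = 3 + K + (?l + 3) * Suc B"
      unfolding add_mult_distrib by linarith
    also have "\<dots> \<le> 3 + K + ?w * Suc B" by (intro add_left_mono mult_le_mono1 l)
    finally have 1: "t' \<le> ?l * (3 + K + ?w * Suc B)"
      using t'(3) by (meson le_trans mult_le_mono2)
    have "3 * (3 + K + 3 * Suc B) \<le> 3 * (3 + K + ?w * Suc B)"
      using l by (intro mult_le_mono2 add_left_mono mult_le_mono1) linarith
    with t(3) have "t \<le> 3 * (3 + K + ?w * Suc B)" by (rule order_trans)
    then have "t + t' \<le> (?l + 3) * (3 + K + ?w * Suc B)"
      using 1 unfolding add_mult_distrib by linarith
    also have "\<dots> \<le> ?w * (3 + K + ?w * Suc B)" by (rule mult_le_mono1[OF l])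
    finally have T: "t + t' \<le> ?w * (3 + K + ?w * Suc B)" .
    have "K + 3 * Suc B + ?l * Suc B = K + (?l + 3) * Suc B"
      unfolding add_mult_distrib by linarith
    also have "\<dots> \<le> K + ?w * Suc B" by (intro add_left_mono mult_le_mono1 l)
    finally have "bounded_state N B (K + ?w * Suc B) (run (Loop x k c) s)"
      unfolding r by (rule bounded_state_mono[OF t'(1)])
    moreover have "exec (compile (Loop x k c)) s (t + t') (run (Loop x k c) s)"
      unfolding r compile.simps using t(2) t'(2) by (rule exec.Seq)
    ultimately show "bounded_state N B (K + ?w * Suc B) (run (Loop x k c) s) \<and>
      (\<exists>t. exec (compile (Loop x k c)) s t (run (Loop x k c) s) \<and> t \<le> ?w * (3 + K + ?w * Suc B))"
      using T by blast
  qed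
qed

section \<open>Polynomial running time in the input size\<close>

lemma work_poly: "\<exists>q :: nat poly. \<forall>N. work N c = poly q N"
proof (induction c)
  case Nop
  then show ?case by (intro exI[of _ "[:1:]"]) simp
next
  case (Assign x i a)
  then show ?case by (intro exI[of _ "[:asize i + asize a + 1:]"]) simp
next
  case (Then c d)
  then obtain p q where "\<forall>N. work N c = poly p N" "\<forall>N. work N d = poly q N" by blast
  then show ?case by (intro exI[of _ "p + q"]) simp
next
  case (Branch a c d)
  then obtain p q where "\<forall>N. work N c = poly p N" "\<forall>N. work N d = poly q N" by blast
  then show ?case by (intro exI[of _ "p + q + [:asize a + 1:]"]) simp
next
  case (Loop x k c)
  then obtain p where "\<forall>N. work N c = poly p N" by blast
  then show ?case
    by (intro exI[of _ "[:k + 15:] + [:0, 1:] * (p + [:k + 15:])"]) simp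
qed

lemma less_power_bits: "n < 2 ^ bits n"
proof -
  have "n < 2 ^ floorlog 2 n"
    by (cases "n = 0") (use floorlog_bounds[of n 2] in auto)
  also have "(2::nat) ^ floorlog 2 n \<le> 2 ^ bits n" unfolding bits_def by (intro power_increasing) auto
  finally show ?thesis .
qed

lemma length_le_input_size: "length xs \<le> input_size xs"
  unfolding input_size_def bits_def by (induction xs) auto

lemma nth_less_input_size:
  assumes "i < length xs"
  shows "xs ! i < 2 ^ input_size xs"
proof -
  have "bits (xs ! i) \<le> input_size xs"
    unfolding input_size_def using assms by (intro member_le_sum_list) auto
  then have "(2::nat) ^ bits (xs ! i) \<le> 2 ^ input_size xs" by (intro power_increasing) auto
  with less_power_bits show ?thesis by (rule less_le_trans)
qed

text \<open>The input size serves as all three bounds. The third premise limits the numbers of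
  rounds; encoded instances satisfy it because every counted vertex and edge occupies cells of its
  own.\<close>

lemma compile_correct:
  assumes "tame c" "length xs \<ge> 3" "\<And>k. k < 3 \<Longrightarrow> xs ! k \<le> length xs"
  shows "\<exists>t. exec (compile c) (initial_state xs) t (run c (initial_state xs)) \<and>
    t \<le> work (input_size xs) c * (3 + input_size xs + work (input_size xs) c * Suc (input_size xs))"
proof -
  let ?n = "input_size xs"
  have "length xs < 2 ^ ?n"
    using length_le_input_size[of xs] less_exp[of ?n] by linarith
  then have "bounded_state ?n ?n ?n (initial_state xs)"
    using nth_less_input_size[of _ xs] assms(2,3) length_le_input_size[of xs]
    by (auto simp: bounded_state_def initial_state_def intro: order_trans)
  then show ?thesis using costs_compile[OF assms(1), of ?n ?n] unfolding costs_def by blast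
qed

lemma polynomial_time_compile:
  assumes "tame c" "\<And>xs. xs \<in> X \<Longrightarrow> length xs \<ge> 3 \<and> (\<forall>k<3. xs ! k \<le> length xs)"
  shows "polynomial_time (compile c) X"
proof -
  obtain w :: "nat poly" where w: "\<And>N. work N c = poly w N" using work_poly by blast
  let ?q = "w * ([:3, 1:] + w * [:1, 1:])"
  show ?thesis
    unfolding polynomial_time_def
  proof (intro exI[of _ ?q] ballI)
    fix xs
    assume "xs \<in> X"
    with assms(2) have "length xs \<ge> 3" "\<And>k. k < 3 \<Longrightarrow> xs ! k \<le> length xs" by auto
    from compile_correct[OF assms(1) this] obtain t where
      "exec (compile c) (initial_state xs) t (run c (initial_state xs))"
      "t \<le> work (input_size xs) c * (3 + input_size xs + work (input_size xs) c * Suc (input_size xs))"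
      by blast
    moreover have "poly ?q (input_size xs) =
        work (input_size xs) c * (3 + input_size xs + work (input_size xs) c * Suc (input_size xs))"
      by (simp add: w algebra_simps)
    ultimately show "\<exists>t s. exec (compile c) (initial_state xs) t s \<and> t \<le> poly ?q (input_size xs)"
      by metis
  qed
qed


section \<open>Greedy allocation of slots\<close>

text \<open>The capacity of a right vertex is represented by slots: an active edge \<open>f\<close> also names a slot at
  its right end, and the number of active edges at a right vertex is the smaller of its capacity
  and its degree.\<close>

locale slots =
  fixes m :: nat and lft rgt bud :: "nat \<Rightarrow> nat" and act :: "nat \<Rightarrow> bool" and lim :: "nat \<Rightarrow> nat"
begin

section \<open>Packings of the edges of one vertex at a fixed price\<close>

definition eligible :: "nat \<Rightarrow> nat \<Rightarrow> (nat \<Rightarrow> nat) \<Rightarrow> nat \<Rightarrow> nat \<Rightarrow> bool" where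
  "eligible u p used i f \<longleftrightarrow> i < m \<and> lft i = u \<and> p \<le> bud i \<and> used i = 0 \<and> f < m \<and> act f \<and> rgt f = rgt i"

definition packing :: "nat \<Rightarrow> nat \<Rightarrow> (nat \<Rightarrow> nat) \<Rightarrow> nat set \<Rightarrow> (nat \<Rightarrow> nat) \<Rightarrow> bool" where
  "packing u p used A \<tau> \<longleftrightarrow> inj_on \<tau> A \<and> (\<forall>i\<in>A. eligible u p used i (\<tau> i))"

lemma packing_finite: "packing u p used A \<tau> \<Longrightarrow> A \<subseteq> {..<m} \<and> finite A"
  unfolding packing_def eligible_def by (auto intro: finite_subset[of _ "{..<m}"])

text \<open>Some best continuation begins with the most profitable pair \<open>(i0, f0)\<close>. If
  \<open>A\<close> uses \<open>i0\<close> and \<open>f0\<close> in different pairs, the edge in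
  \<open>f0\<close> moves to the slot that \<open>i0\<close> leaves. Otherwise removing one pair
  leaves both \<open>i0\<close> and \<open>f0\<close> free, and by maximality the removed gain is at
  most that of \<open>(i0, f0)\<close>. Either way a nonempty \<open>A\<close> loses one
  edge.\<close>

lemma packing_exchange:
  assumes A: "packing u p used A \<tau>" and max: "eligible u p used i0 f0"
    "\<And>i f. eligible u p used i f \<Longrightarrow> p - val f \<le> p - val f0"
  shows "\<exists>A' \<tau>'. packing u p (used(i0 := 1)) A' \<tau>' \<and> card A' \<le> card A - 1 \<and>
    (\<Sum>i\<in>A. p - val (\<tau> i)) \<le> p - val f0 + (\<Sum>i\<in>A'. p - (val(f0 := p)) (\<tau>' i))"
proof -
  have fin: "finite A" using packing_finite[OF A] by simp
  have inj: "inj_on \<tau> A" and el: "\<And>i. i \<in> A \<Longrightarrow> eligible u p used i (\<tau> i)"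
    using A by (auto simp: packing_def)
  \<comment> \<open>Covers every case in which the rest of \<open>A\<close> avoids both
    \<open>i0\<close> and \<open>f0\<close>: here \<open>j\<close> is \<open>i0\<close>, the edge in
    \<open>f0\<close>, or arbitrary. Raising the value of \<open>f0\<close> then leaves the other
    gains unchanged.\<close>
  have remove: ?thesis if j: "j \<in> A" "i0 \<notin> A - {j}" "f0 \<notin> \<tau> ` (A - {j})" for j
  proof (intro exI conjI)
    show "packing u p (used(i0 := 1)) (A - {j}) \<tau>"
      using j(2) el inj_on_subset[OF inj] by (auto simp: packing_def eligible_def)
    show "card (A - {j}) \<le> card A - 1" using j fin by simp
    have "(\<Sum>i\<in>A. p - val (\<tau> i)) = p - val (\<tau> j) + (\<Sum>i\<in>A - {j}. p - val (\<tau> i))"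
      using fin j by (simp add: sum.remove)
    also have "(\<Sum>i\<in>A - {j}. p - val (\<tau> i)) = (\<Sum>i\<in>A - {j}. p - (val(f0 := p)) (\<tau> i))"
      using j(3) by (intro sum.cong) auto
    finally show "(\<Sum>i\<in>A. p - val (\<tau> i)) \<le> p - val f0 + (\<Sum>i\<in>A - {j}. p - (val(f0 := p)) (\<tau> i))"
      using max(2)[OF el[OF j(1)]] by simp
  qed
  show ?thesis
  proof (cases "i0 \<in> A")
    case True
    show ?thesis
    proof (cases "f0 \<in> \<tau> ` (A - {i0})")
      case False
      then show ?thesis using remove[of i0] True by blast
    next
      case fA: True
      then obtain j where j: "j \<in> A" "j \<noteq> i0" "\<tau> j = f0" by blast
      have ne: "\<tau> i0 \<noteq> f0" using j True inj by (auto simp: inj_on_def)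
      \<comment> \<open>\<open>j\<close> holds \<open>f0\<close>, and \<open>i0\<close> is eligible
        for \<open>f0\<close>, so \<open>j\<close> and \<open>i0\<close> share their right end and
        the slot of \<open>i0\<close> suits \<open>j\<close>.\<close>
      let ?t = "\<tau>(j := \<tau> i0)"
      show ?thesis
      proof (intro exI conjI)
        have "inj_on ?t (A - {i0})"
          using inj True by (auto simp: inj_on_def)
        moreover have "eligible u p (used(i0 := 1)) i (?t i)" if "i \<in> A - {i0}" for i
          using that el[of i] el[OF True] el[OF j(1)] max(1) j by (auto simp: eligible_def)
        ultimately show "packing u p (used(i0 := 1)) (A - {i0}) ?t" by (simp add: packing_def)
        show "card (A - {i0}) \<le> card A - 1" using True fin by simp
        have rest: "(\<Sum>i\<in>A - {i0} - {j}. p - val (\<tau> i)) =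
            (\<Sum>i\<in>A - {i0} - {j}. p - (val(f0 := p)) (?t i))"
          using j inj by (intro sum.cong) (auto simp: inj_on_def)
        have "(\<Sum>i\<in>A. p - val (\<tau> i)) =
            p - val (\<tau> i0) + (p - val f0 + (\<Sum>i\<in>A - {i0} - {j}. p - val (\<tau> i)))"
          using fin j True by (simp add: sum.remove[of A i0] sum.remove[of "A - {i0}" j])
        also have "p - val (\<tau> i0) = p - (val(f0 := p)) (?t j)" using ne by simp
        also have "p - (val(f0 := p)) (?t j) +
            (p - val f0 + (\<Sum>i\<in>A - {i0} - {j}. p - val (\<tau> i))) =
            p - val f0 + (\<Sum>i\<in>A - {i0}. p - (val(f0 := p)) (?t i))"
          unfolding rest
          using sum.remove[of "A - {i0}" j "\<lambda>i. p - (val(f0 := p)) (?t i)"] fin j(1,2) by simp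
        finally show "(\<Sum>i\<in>A. p - val (\<tau> i)) \<le>
            p - val f0 + (\<Sum>i\<in>A - {i0}. p - (val(f0 := p)) (?t i))" by simp
      qed
    qed
  next
    case i0: False
    show ?thesis
    proof (cases "A = {}")
      case True
      then show ?thesis by (intro exI[of _ "{}"]) (simp add: packing_def)
    next
      case False
      show ?thesis
      proof (cases "f0 \<in> \<tau> ` A")
        case True
        then obtain j where "j \<in> A" "\<tau> j = f0" by blast
        moreover from this have "f0 \<notin> \<tau> ` (A - {j})" using inj by (auto simp: inj_on_def)
        ultimately show ?thesis using remove i0 by blast
      next
        case f0: False
        from False obtain j where "j \<in> A" by blast
        then show ?thesis using remove[of j] i0 f0 by blast
      qed
    qed
  qed
qed

text \<open>An array entry \<open>occ f = Suc i\<close> says that slot \<open>f\<close> is occupied by edge \<open>i\<close>, and \<open>0\<close> that it is free;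
  \<open>ch u = Suc c\<close> says that the price of \<open>u\<close> is the budget of edge \<open>c\<close>, and \<open>0\<close> that the price is zero.
  The value of a slot is the price paid by its occupant.\<close>

definition solution ::
    "nat set \<Rightarrow> (nat \<Rightarrow> nat) \<Rightarrow> (nat \<Rightarrow> nat) \<Rightarrow> (nat \<Rightarrow> nat) \<Rightarrow> bool" where
  "solution U ch val occ \<longleftrightarrow>
     (\<forall>f<m. occ f = 0 \<longrightarrow> val f = 0) \<and>
     (\<forall>f<m. \<forall>i. occ f = Suc i \<longrightarrow> i < m \<and> act f \<and> rgt f = rgt i \<and> lft i \<in> U \<and>
        ch (lft i) \<noteq> 0 \<and> val f = bud (ch (lft i) - 1) \<and> val f \<le> bud i) \<and>
     inj_on occ {f. f < m \<and> occ f \<noteq> 0} \<and>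
     (\<forall>u\<in>U. card {f. f < m \<and> occ f \<noteq> 0 \<and> lft (occ f - 1) = u} \<le> lim u) \<and>
     (\<forall>u\<in>U. ch u \<noteq> 0 \<longrightarrow> ch u - 1 < m \<and> lft (ch u - 1) = u)"

text \<open>A feasible solution in terms of slots: the injection \<open>\<sigma>\<close> replaces
  the right capacities, and \<open>cs u\<close> names an edge at \<open>u\<close> whose budget
  stands for the price of \<open>u\<close>.\<close>

definition rival :: "nat set \<Rightarrow> (nat \<Rightarrow> nat) \<Rightarrow> (nat \<Rightarrow> nat) \<Rightarrow> bool" where
  "rival F \<sigma> cs \<longleftrightarrow> F \<subseteq> {..<m} \<and> inj_on \<sigma> F \<and>
     (\<forall>i\<in>F. \<sigma> i < m \<and> act (\<sigma> i) \<and> rgt (\<sigma> i) = rgt i \<and>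
        cs (lft i) < m \<and> lft (cs (lft i)) = lft i \<and> bud (cs (lft i)) \<le> bud i) \<and>
     (\<forall>u. card {i \<in> F. lft i = u} \<le> lim u)"

text \<open>The invariant carried along the served vertices. A term vanishes by truncation once the
  slot is worth at least the rival's price, so growing slot values can only help.\<close>

definition competitive :: "nat set \<Rightarrow> (nat \<Rightarrow> nat) \<Rightarrow> bool" where
  "competitive U val \<longleftrightarrow> (\<forall>F \<sigma> cs. rival F \<sigma> cs \<longrightarrow>
     (\<Sum>i | i \<in> F \<and> lft i \<in> U. bud (cs (lft i)) - val (\<sigma> i)) \<le> (\<Sum>f<m. val f))"

text \<open>Slots are injectively assigned to the edges of the rival, so the subtracted values total at
  most the value of the solution.\<close>

lemma competitive_ratio:
  assumes "competitive U val" "rival F \<sigma> cs" "\<And>i. i \<in> F \<Longrightarrow> lft i \<in> U"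
  shows "(\<Sum>i\<in>F. bud (cs (lft i))) \<le> 2 * (\<Sum>f<m. val f)"
proof -
  have F: "{i. i \<in> F \<and> lft i \<in> U} = F" using assms(3) by auto
  have "(\<Sum>i\<in>F. bud (cs (lft i))) \<le> (\<Sum>i\<in>F. (bud (cs (lft i)) - val (\<sigma> i)) + val (\<sigma> i))"
    by (intro sum_mono) simp
  also have "\<dots> = (\<Sum>i\<in>F. bud (cs (lft i)) - val (\<sigma> i)) + (\<Sum>i\<in>F. val (\<sigma> i))"
    by (simp add: sum.distrib)
  also have "(\<Sum>i\<in>F. val (\<sigma> i)) = sum val (\<sigma> ` F)"
    using assms(2) by (simp add: rival_def sum.reindex)
  also have "sum val (\<sigma> ` F) \<le> (\<Sum>f<m. val f)"
    using assms(2) by (intro sum_mono2) (auto simp: rival_def)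
  also have "(\<Sum>i\<in>F. bud (cs (lft i)) - val (\<sigma> i)) \<le> (\<Sum>f<m. val f)"
    using assms(1)[unfolded competitive_def, rule_format, OF assms(2)] F by simp
  finally show ?thesis by simp
qed

lemma competitive_cong:
  assumes "competitive U val" "\<And>f. f < m \<Longrightarrow> val' f = val f"
  shows "competitive U val'"
  unfolding competitive_def
proof (intro allI impI)
  fix F \<sigma> cs
  assume R: "rival F \<sigma> cs"
  then have "(\<Sum>i | i \<in> F \<and> lft i \<in> U. bud (cs (lft i)) - val' (\<sigma> i)) =
      (\<Sum>i | i \<in> F \<and> lft i \<in> U. bud (cs (lft i)) - val (\<sigma> i))"
    using assms(2) by (intro sum.cong) (auto simp: rival_def)
  also have "\<dots> \<le> (\<Sum>f<m. val f)" using assms(1) R by (simp add: competitive_def)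
  also have "\<dots> = (\<Sum>f<m. val' f)" using assms(2) by simp
  finally show "(\<Sum>i | i \<in> F \<and> lft i \<in> U. bud (cs (lft i)) - val' (\<sigma> i)) \<le> (\<Sum>f<m. val' f)" .
qed

text \<open>The state after \<open>r\<close> rounds at price \<open>p\<close>. The last conjunct
  certifies optimality: no packing gains more than \<open>gain\<close> plus what some packing of the
  edges not yet placed gains over the current values, and the size allowed for this residual packing
  shrinks with \<open>r\<close>. The minimum with \<open>m\<close> makes it empty after
  \<open>m\<close> rounds even if \<open>lim u\<close> is larger.\<close>

definition trial ::
    "nat \<Rightarrow> nat \<Rightarrow> (nat \<Rightarrow> nat) \<Rightarrow> (nat \<Rightarrow> nat) \<Rightarrow>
     nat \<Rightarrow> (nat \<Rightarrow> nat) \<Rightarrow> (nat \<Rightarrow> nat) \<Rightarrow> (nat \<Rightarrow> nat) \<Rightarrow> nat \<Rightarrow> bool" where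
  "trial u p val occ r tval tocc used gain \<longleftrightarrow>
     (\<forall>f<m. (tocc f = occ f \<and> tval f = val f) \<or>
        (\<exists>i. tocc f = Suc i \<and> i < m \<and> used i \<noteq> 0 \<and> tval f = p \<and> act f \<and> rgt f = rgt i \<and> val f \<le> p)) \<and>
     (\<forall>i<m. used i \<noteq> 0 \<longrightarrow> lft i = u \<and> p \<le> bud i) \<and>
     inj_on tocc {f. f < m \<and> tocc f \<noteq> 0} \<and>
     card {i. i < m \<and> used i \<noteq> 0} \<le> min r (lim u) \<and>
     (\<Sum>f<m. tval f) = (\<Sum>f<m. val f) + gain \<and>
     (\<forall>A \<tau>. packing u p (\<lambda>_. 0) A \<tau> \<and> card A \<le> lim u \<longrightarrow>
        (\<exists>A' \<tau>'. packing u p used A' \<tau>' \<and> card A' \<le> min m (lim u) - r \<and>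
           (\<Sum>i\<in>A. p - val (\<tau> i)) \<le> gain + (\<Sum>i\<in>A'. p - tval (\<tau>' i))))"

lemma trial_init:
  assumes "solution U ch val occ" "\<And>f. f < m \<Longrightarrow> tval f = val f"
    "\<And>f. f < m \<Longrightarrow> tocc f = occ f" "\<And>i. i < m \<Longrightarrow> used i = 0"
  shows "trial u p val occ 0 tval tocc used 0"
proof -
  have e: "{i. i < m \<and> used i \<noteq> 0} = {}" using assms(4) by auto
  have "packing u p used A \<tau>" "card A \<le> m" "(\<Sum>i\<in>A. p - val (\<tau> i)) = (\<Sum>i\<in>A. p - tval (\<tau> i))"
    if A: "packing u p (\<lambda>_. 0) A \<tau>" for A \<tau>
  proof -
    show "packing u p used A \<tau>" using A assms(4) by (auto simp: packing_def eligible_def)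
    have "card A \<le> card {..<m}" using packing_finite[OF A] by (intro card_mono) auto
    then show "card A \<le> m" by simp
    show "(\<Sum>i\<in>A. p - val (\<tau> i)) = (\<Sum>i\<in>A. p - tval (\<tau> i))"
      using A assms(2) by (intro sum.cong) (auto simp: packing_def eligible_def)
  qed
  then have "\<forall>A \<tau>. packing u p (\<lambda>_. 0) A \<tau> \<and> card A \<le> lim u \<longrightarrow>
        (\<exists>A' \<tau>'. packing u p used A' \<tau>' \<and> card A' \<le> min m (lim u) - 0 \<and>
           (\<Sum>i\<in>A. p - val (\<tau> i)) \<le> 0 + (\<Sum>i\<in>A'. p - tval (\<tau>' i)))"
    by (metis add_0 diff_zero le_refl min.boundedI)
  moreover have "inj_on tocc {f. f < m \<and> tocc f \<noteq> 0}"
  proof -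
    have "inj_on occ {f. f < m \<and> tocc f \<noteq> 0} \<longleftrightarrow> inj_on tocc {f. f < m \<and> tocc f \<noteq> 0}"
      using assms(3) by (intro inj_on_cong) auto
    moreover have "{f. f < m \<and> tocc f \<noteq> 0} = {f. f < m \<and> occ f \<noteq> 0}" using assms(3) by auto
    ultimately show ?thesis using assms(1) unfolding solution_def by simp
  qed
  ultimately show ?thesis
    unfolding trial_def e using assms by auto
qed

text \<open>\<open>packing_exchange\<close>, applied to the residual packing, yields the new
  certificate. The price exceeds the present value of the slot, so the total rises by exactly the
  gain.\<close>

lemma trial_step:
  assumes sol: "solution U ch val occ" "u \<notin> U"
    and T: "trial u p val occ r tval tocc used gain" "r < lim u"
    and max: "eligible u p used i0 f0" "\<And>i f. eligible u p used i f \<Longrightarrow> p - tval f \<le> p - tval f0"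
      "tval f0 < p"
  shows "trial u p val occ (Suc r) (tval(f0 := p)) (tocc(f0 := Suc i0)) (used(i0 := 1))
    (gain + (p - tval f0))"
proof -
  have el: "i0 < m" "lft i0 = u" "p \<le> bud i0" "used i0 = 0" "f0 < m" "act f0" "rgt f0 = rgt i0"
    using max(1) by (auto simp: eligible_def)
  have 1: "\<And>f. f < m \<Longrightarrow> (tocc f = occ f \<and> tval f = val f) \<or>
        (\<exists>i. tocc f = Suc i \<and> i < m \<and> used i \<noteq> 0 \<and> tval f = p \<and> act f \<and> rgt f = rgt i \<and> val f \<le> p)"
    and 2: "\<forall>i<m. used i \<noteq> 0 \<longrightarrow> lft i = u \<and> p \<le> bud i"
    and 3: "inj_on tocc {f. f < m \<and> tocc f \<noteq> 0}"
    and 4: "card {i. i < m \<and> used i \<noteq> 0} \<le> min r (lim u)"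
    and 5: "(\<Sum>f<m. tval f) = (\<Sum>f<m. val f) + gain"
    and 6: "\<And>A \<tau>. packing u p (\<lambda>_. 0) A \<tau> \<Longrightarrow> card A \<le> lim u \<Longrightarrow>
        (\<exists>A' \<tau>'. packing u p used A' \<tau>' \<and> card A' \<le> min m (lim u) - r \<and>
           (\<Sum>i\<in>A. p - val (\<tau> i)) \<le> gain + (\<Sum>i\<in>A'. p - tval (\<tau>' i)))"
    using T(1) unfolding trial_def by auto
  have "val f0 \<le> tval f0" using 1[OF el(5)] max(3) by auto
  then have c1: "\<forall>f<m. ((tocc(f0 := Suc i0)) f = occ f \<and> (tval(f0 := p)) f = val f) \<or>
        (\<exists>i. (tocc(f0 := Suc i0)) f = Suc i \<and> i < m \<and> (used(i0 := 1)) i \<noteq> 0 \<and>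
          (tval(f0 := p)) f = p \<and> act f \<and> rgt f = rgt i \<and> val f \<le> p)"
  proof (intro allI impI)
    fix f
    assume "f < m"
    show "((tocc(f0 := Suc i0)) f = occ f \<and> (tval(f0 := p)) f = val f) \<or>
        (\<exists>i. (tocc(f0 := Suc i0)) f = Suc i \<and> i < m \<and> (used(i0 := 1)) i \<noteq> 0 \<and>
          (tval(f0 := p)) f = p \<and> act f \<and> rgt f = rgt i \<and> val f \<le> p)"
    proof (cases "f = f0")
      case True
      then show ?thesis using el max(3) \<open>val f0 \<le> tval f0\<close> by simp
    next
      case False
      then show ?thesis using 1[OF \<open>f < m\<close>] by auto
    qed
  qed
  have c2: "\<forall>i<m. (used(i0 := 1)) i \<noteq> 0 \<longrightarrow> lft i = u \<and> p \<le> bud i" using 2 el by auto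
  \<comment> \<open>Occupants from before the trial have left ends in \<open>U\<close>, which lacks
    \<open>u\<close>; occupants placed during it are marked in \<open>used\<close>. Edge
    \<open>i0\<close> is neither.\<close>
  have fresh: "tocc f \<noteq> Suc i0" if "f < m" for f
    using 1[OF that] sol el that unfolding solution_def by (metis nat.inject)
  have c3: "inj_on (tocc(f0 := Suc i0)) {f. f < m \<and> (tocc(f0 := Suc i0)) f \<noteq> 0}"
    using 3 fresh unfolding inj_on_def by (auto split: if_splits) metis
  have "{i. i < m \<and> (used(i0 := 1)) i \<noteq> 0} = insert i0 {i. i < m \<and> used i \<noteq> 0}"
    using el by auto
  then have c4: "card {i. i < m \<and> (used(i0 := 1)) i \<noteq> 0} \<le> min (Suc r) (lim u)"
    using 4 T(2) el by (simp add: card_insert_if)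
  have c5: "(\<Sum>f<m. (tval(f0 := p)) f) = (\<Sum>f<m. val f) + (gain + (p - tval f0))"
  proof -
    have "(\<Sum>f<m. (tval(f0 := p)) f) = p + (\<Sum>f\<in>{..<m} - {f0}. tval f)"
      using el(5) by (simp add: sum.remove[of _ f0])
    moreover have "(\<Sum>f<m. tval f) = tval f0 + (\<Sum>f\<in>{..<m} - {f0}. tval f)"
      using el(5) by (simp add: sum.remove[of _ f0])
    ultimately show ?thesis using 5 max(3) by simp
  qed
  have c6: "\<exists>A' \<tau>'. packing u p (used(i0 := 1)) A' \<tau>' \<and> card A' \<le> min m (lim u) - Suc r \<and>
      (\<Sum>i\<in>A. p - val (\<tau> i)) \<le> gain + (p - tval f0) + (\<Sum>i\<in>A'. p - (tval(f0 := p)) (\<tau>' i))"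
    if A: "packing u p (\<lambda>_. 0) A \<tau>" "card A \<le> lim u" for A \<tau>
  proof -
    from 6[OF A] obtain A1 \<tau>1 where A1: "packing u p used A1 \<tau>1" "card A1 \<le> min m (lim u) - r"
      "(\<Sum>i\<in>A. p - val (\<tau> i)) \<le> gain + (\<Sum>i\<in>A1. p - tval (\<tau>1 i))" by blast
    from packing_exchange[of u p used A1 \<tau>1 i0 f0 tval, OF A1(1) max(1)] max(2) obtain A' \<tau>' where
      "packing u p (used(i0 := 1)) A' \<tau>'" "card A' \<le> card A1 - 1"
      "(\<Sum>i\<in>A1. p - tval (\<tau>1 i)) \<le> p - tval f0 + (\<Sum>i\<in>A'. p - (tval(f0 := p)) (\<tau>' i))" by blast
    with A1 show ?thesis by (intro exI[of _ A'] exI[of _ \<tau>']) linarith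
  qed
  show ?thesis unfolding trial_def using c1 c2 c3 c4 c5 c6 by (intro conjI allI impI) blast+
qed

text \<open>The residual packing gains nothing: either no edge may be added any more and it is
  empty, or no eligible pair has positive gain. The empty packing can replace it as certificate for
  the next round.\<close>

lemma trial_idle:
  assumes T: "trial u p val occ r tval tocc used gain"
    and idle: "lim u \<le> r \<or> (\<forall>i f. eligible u p used i f \<longrightarrow> p \<le> tval f)"
  shows "trial u p val occ (Suc r) tval tocc used gain"
proof -
  have "\<exists>A' \<tau>'. packing u p used A' \<tau>' \<and> card A' \<le> min m (lim u) - Suc r \<and>
      (\<Sum>i\<in>A. p - val (\<tau> i)) \<le> gain + (\<Sum>i\<in>A'. p - tval (\<tau>' i))"
    if A: "packing u p (\<lambda>_. 0) A \<tau>" "card A \<le> lim u" for A \<tau>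
  proof -
    from T A obtain A1 \<tau>1 where A1: "packing u p used A1 \<tau>1" "card A1 \<le> min m (lim u) - r"
      "(\<Sum>i\<in>A. p - val (\<tau> i)) \<le> gain + (\<Sum>i\<in>A1. p - tval (\<tau>1 i))"
      unfolding trial_def by blast
    have "(\<Sum>i\<in>A1. p - tval (\<tau>1 i)) = 0"
      using idle
    proof
      assume "lim u \<le> r"
      with A1(2) packing_finite[OF A1(1)] show ?thesis by simp
    next
      assume "\<forall>i f. eligible u p used i f \<longrightarrow> p \<le> tval f"
      with A1(1) have "\<forall>i\<in>A1. p \<le> tval (\<tau>1 i)" unfolding packing_def by blast
      then show ?thesis by simp
    qed
    with A1(3) show ?thesis by (intro exI[of _ "{}"]) (simp add: packing_def)
  qed
  then show ?thesis using T unfolding trial_def by auto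
qed

text \<open>Evictions only lower the counts at vertices of \<open>U\<close>, whose prices stay as
  they were, and a solution may always sell fewer edges. All edges sold at \<open>u\<close> are
  marked in \<open>used\<close>, and at most \<open>lim u\<close> edges are.\<close>

lemma trial_solution:
  assumes sol: "solution U ch val occ" "u \<notin> U"
    and T: "trial u (bud c) val occ r tval tocc used gain"
    and c: "c < m" "lft c = u"
  shows "solution (insert u U) (ch(u := Suc c)) tval tocc" "\<forall>f<m. val f \<le> tval f"
proof -
  let ?p = "bud c"
  have 1: "\<And>f. f < m \<Longrightarrow> (tocc f = occ f \<and> tval f = val f) \<or>
        (\<exists>i. tocc f = Suc i \<and> i < m \<and> used i \<noteq> 0 \<and> tval f = ?p \<and> act f \<and> rgt f = rgt i \<and> val f \<le> ?p)"
    and 2: "\<And>i. i < m \<Longrightarrow> used i \<noteq> 0 \<Longrightarrow> lft i = u \<and> ?p \<le> bud i"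
    and 3: "inj_on tocc {f. f < m \<and> tocc f \<noteq> 0}"
    and 4: "card {i. i < m \<and> used i \<noteq> 0} \<le> lim u"
    using T unfolding trial_def by auto
  have s: "\<And>f. f < m \<Longrightarrow> occ f = 0 \<Longrightarrow> val f = 0"
    "\<And>f i. f < m \<Longrightarrow> occ f = Suc i \<Longrightarrow> i < m \<and> act f \<and> rgt f = rgt i \<and> lft i \<in> U \<and>
        ch (lft i) \<noteq> 0 \<and> val f = bud (ch (lft i) - 1) \<and> val f \<le> bud i"
    "\<And>u. u \<in> U \<Longrightarrow> card {f. f < m \<and> occ f \<noteq> 0 \<and> lft (occ f - 1) = u} \<le> lim u"
    "\<And>u. u \<in> U \<Longrightarrow> ch u \<noteq> 0 \<longrightarrow> ch u - 1 < m \<and> lft (ch u - 1) = u"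
    using sol(1) unfolding solution_def by auto
  show "\<forall>f<m. val f \<le> tval f" using 1 by fastforce
  have c1: "tval f = 0" if "f < m" "tocc f = 0" for f using 1[OF that(1)] s(1)[OF that(1)] that(2) by auto
  have c2: "i < m \<and> act f \<and> rgt f = rgt i \<and> lft i \<in> insert u U \<and>
        (ch(u := Suc c)) (lft i) \<noteq> 0 \<and> tval f = bud ((ch(u := Suc c)) (lft i) - 1) \<and> tval f \<le> bud i"
    if f: "f < m" "tocc f = Suc i" for f i
    using 1[OF f(1)]
  proof
    assume "tocc f = occ f \<and> tval f = val f"
    with s(2)[OF f(1)] f(2) sol(2) show ?thesis by auto
  next
    assume "\<exists>i. tocc f = Suc i \<and> i < m \<and> used i \<noteq> 0 \<and> tval f = ?p \<and> act f \<and> rgt f = rgt i \<and> val f \<le> ?p"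
    with f(2) 2[of i] show ?thesis by auto
  qed
  have c4: "card {f. f < m \<and> tocc f \<noteq> 0 \<and> lft (tocc f - 1) = w} \<le> lim w" if w: "w \<in> insert u U" for w
  proof (cases "w = u")
    case True
    let ?S = "{f. f < m \<and> tocc f \<noteq> 0 \<and> lft (tocc f - 1) = u}"
    have "inj_on (\<lambda>f. tocc f - 1) ?S"
    proof (rule inj_onI)
      fix f g
      assume fg: "f \<in> ?S" "g \<in> ?S" "tocc f - 1 = tocc g - 1"
      then have "tocc f \<noteq> 0" "tocc g \<noteq> 0" by blast+
      with fg(3) have "tocc f = tocc g" by linarith
      moreover from fg(1,2) have "f \<in> {f. f < m \<and> tocc f \<noteq> 0}" "g \<in> {f. f < m \<and> tocc f \<noteq> 0}"
        by simp_all
      ultimately show "f = g" by (rule inj_onD[OF 3])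
    qed
    moreover have "(\<lambda>f. tocc f - 1) ` ?S \<subseteq> {i. i < m \<and> used i \<noteq> 0}"
    proof (rule image_subsetI)
      fix f
      assume "f \<in> ?S"
      then have f: "f < m" "tocc f \<noteq> 0" "u = lft (tocc f - 1)" by simp_all
      then obtain i where i: "tocc f = Suc i" by (cases "tocc f") auto
      have "\<not> (occ f = Suc i)" using s(2)[OF f(1), of i] f(3) i sol(2) by auto
      then show "tocc f - 1 \<in> {i. i < m \<and> used i \<noteq> 0}" using 1[OF f(1)] i by auto
    qed
    ultimately have "card ?S \<le> card {i. i < m \<and> used i \<noteq> 0}" by (intro card_inj_on_le) auto
    with 4 True show ?thesis by simp
  next
    case False
    then have "w \<in> U" using w by simp
    have "{f. f < m \<and> tocc f \<noteq> 0 \<and> lft (tocc f - 1) = w} \<subseteq> {f. f < m \<and> occ f \<noteq> 0 \<and> lft (occ f - 1) = w}"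
    proof
      fix f
      assume "f \<in> {f. f < m \<and> tocc f \<noteq> 0 \<and> lft (tocc f - 1) = w}"
      then have f: "f < m" "tocc f \<noteq> 0" "w = lft (tocc f - 1)" by simp_all
      have "tocc f = occ f"
        using 1[OF f(1)]
      proof
        assume "\<exists>i. tocc f = Suc i \<and> i < m \<and> used i \<noteq> 0 \<and> tval f = ?p \<and> act f \<and> rgt f = rgt i \<and> val f \<le> ?p"
        then obtain i where "tocc f = Suc i" "i < m" "used i \<noteq> 0" by blast
        with 2[of i] f(3) False show ?thesis by simp
      qed simp
      with f show "f \<in> {f. f < m \<and> occ f \<noteq> 0 \<and> lft (occ f - 1) = w}" by simp
    qed
    then have "card {f. f < m \<and> tocc f \<noteq> 0 \<and> lft (tocc f - 1) = w} \<le>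
        card {f. f < m \<and> occ f \<noteq> 0 \<and> lft (occ f - 1) = w}" by (intro card_mono) auto
    with s(3)[OF \<open>w \<in> U\<close>] show ?thesis by linarith
  qed
  show "solution (insert u U) (ch(u := Suc c)) tval tocc"
    unfolding solution_def
  proof (intro conjI)
    show "\<forall>w\<in>insert u U. (ch(u := Suc c)) w \<noteq> 0 \<longrightarrow>
        (ch(u := Suc c)) w - 1 < m \<and> lft ((ch(u := Suc c)) w - 1) = w"
      using s(4) c by auto
  qed (use c1 c2 3 c4 in blast)+
qed

text \<open>The committed and the best allocation share \<open>ch\<close>; when \<open>u\<close>
  lies outside \<open>U\<close>, its entry at \<open>u\<close> may change without affecting the
  committed one. The bound \<open>best\<close> is stated against all packings at the prices already
  considered, because the rival will supply an arbitrary one.\<close>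

definition best_trial ::
    "nat set \<Rightarrow> (nat \<Rightarrow> nat) \<Rightarrow> (nat \<Rightarrow> nat) \<Rightarrow> nat \<Rightarrow> nat \<Rightarrow>
     (nat \<Rightarrow> nat) \<Rightarrow> (nat \<Rightarrow> nat) \<Rightarrow> (nat \<Rightarrow> nat) \<Rightarrow> nat \<Rightarrow> bool" where
  "best_trial U val occ u c ch bval bocc best \<longleftrightarrow>
     solution U ch val occ \<and> solution (insert u U) ch bval bocc \<and>
     (\<Sum>f<m. bval f) = (\<Sum>f<m. val f) + best \<and> (\<forall>f<m. val f \<le> bval f) \<and>
     (\<forall>c'<c. lft c' = u \<longrightarrow> (\<forall>A \<tau>. packing u (bud c') (\<lambda>_. 0) A \<tau> \<and> card A \<le> lim u \<longrightarrow>
        (\<Sum>i\<in>A. bud c' - val (\<tau> i)) \<le> best))"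

lemma solution_change: "solution U ch val occ \<Longrightarrow> u \<notin> U \<Longrightarrow> solution U (ch(u := x)) val occ"
  unfolding solution_def by (auto split: if_splits)

lemma solution_cong:
  assumes "\<And>f. f < m \<Longrightarrow> val f = val' f" "\<And>f. f < m \<Longrightarrow> occ f = occ' f"
  shows "solution U ch val occ \<longleftrightarrow> solution U ch val' occ'"
proof -
  have "{f. f < m \<and> occ f \<noteq> 0 \<and> lft (occ f - 1) = u} =
      {f. f < m \<and> occ' f \<noteq> 0 \<and> lft (occ' f - 1) = u}" for u
    using assms(2) by auto
  moreover have "inj_on occ {f. f < m \<and> occ f \<noteq> 0} \<longleftrightarrow> inj_on occ' {f. f < m \<and> occ f \<noteq> 0}"
    using assms(2) by (intro inj_on_cong) auto
  moreover have "{f. f < m \<and> occ f \<noteq> 0} = {f. f < m \<and> occ' f \<noteq> 0}" using assms(2) by auto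
  ultimately show ?thesis unfolding solution_def using assms by simp
qed

text \<open>Selling nothing at \<open>u\<close> is the baseline with gain zero: no slot holds an
  edge of \<open>u\<close>, since all occupants have left ends in \<open>U\<close>.\<close>

lemma best_trial_init:
  assumes sol: "solution U ch val occ" "u \<notin> U" and ch: "ch u = 0"
    and b: "\<And>f. f < m \<Longrightarrow> bval f = val f" "\<And>f. f < m \<Longrightarrow> bocc f = occ f"
  shows "best_trial U val occ u 0 ch bval bocc 0"
proof -
  have "occ f = 0 \<or> lft (occ f - 1) \<noteq> u" if "f < m" for f
    using sol that unfolding solution_def by (cases "occ f") auto
  then have e: "{f. f < m \<and> occ f \<noteq> 0 \<and> lft (occ f - 1) = u} = {}"
    unfolding Collect_empty_eq by metis
  have "card {f. f < m \<and> occ f \<noteq> 0 \<and> lft (occ f - 1) = u} \<le> lim u" unfolding e by simp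
  then have "solution (insert u U) ch val occ" using sol ch unfolding solution_def by auto
  moreover have "solution (insert u U) ch bval bocc \<longleftrightarrow> solution (insert u U) ch val occ"
    by (intro solution_cong b)
  ultimately show ?thesis using sol(1) b by (simp add: best_trial_def)
qed

lemma best_trial_skip:
  "best_trial U val occ u c ch bval bocc best \<Longrightarrow> lft c \<noteq> u \<Longrightarrow>
    best_trial U val occ u (Suc c) ch bval bocc best"
  unfolding best_trial_def by (auto simp: less_Suc_eq)

text \<open>After \<open>m\<close> rounds the residual packing has at most
  \<open>min m (lim u) - m = 0\<close> edges, so \<open>gain\<close> alone dominates.\<close>

lemma trial_gain:
  assumes "trial u p val occ m tval tocc used gain" "packing u p (\<lambda>_. 0) A \<tau>" "card A \<le> lim u"
  shows "(\<Sum>i\<in>A. p - val (\<tau> i)) \<le> gain"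
proof -
  from assms obtain A' \<tau>' where A': "packing u p used A' \<tau>'" "card A' \<le> min m (lim u) - m"
    "(\<Sum>i\<in>A. p - val (\<tau> i)) \<le> gain + (\<Sum>i\<in>A'. p - tval (\<tau>' i))"
    unfolding trial_def by blast
  with packing_finite[OF A'(1)] have "A' = {}" by simp
  with A'(3) show ?thesis by simp
qed

lemma best_trial_keep:
  assumes "best_trial U val occ u c ch bval bocc best"
    "trial u (bud c) val occ m tval tocc used gain" "gain \<le> best"
  shows "best_trial U val occ u (Suc c) ch bval bocc best"
  using assms(1,3) trial_gain[OF assms(2)]
  unfolding best_trial_def by (auto simp: less_Suc_eq intro: order_trans)

lemma best_trial_improve:
  assumes B: "best_trial U val occ u c ch bval bocc best" "u \<notin> U" "c < m" "lft c = u"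
    and T: "trial u (bud c) val occ m tval tocc used gain" "best \<le> gain"
    and b: "\<And>f. f < m \<Longrightarrow> bval' f = tval f" "\<And>f. f < m \<Longrightarrow> bocc' f = tocc f"
  shows "best_trial U val occ u (Suc c) (ch(u := Suc c)) bval' bocc' gain"
proof -
  have sol: "solution U ch val occ" using B(1) by (simp add: best_trial_def)
  have "solution (insert u U) (ch(u := Suc c)) bval' bocc' \<longleftrightarrow>
      solution (insert u U) (ch(u := Suc c)) tval tocc"
    by (intro solution_cong b)
  moreover have "(\<Sum>f<m. tval f) = (\<Sum>f<m. val f) + gain" using T(1) by (simp add: trial_def)
  moreover have "(\<Sum>i\<in>A. bud c' - val (\<tau> i)) \<le> gain"
    if "c' < Suc c" "lft c' = u" "packing u (bud c') (\<lambda>_. 0) A \<tau>" "card A \<le> lim u" for c' A \<tau>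
  proof (cases "c' = c")
    case True
    then show ?thesis using trial_gain[OF T(1)] that by simp
  next
    case False
    then have "(\<Sum>i\<in>A. bud c' - val (\<tau> i)) \<le> best" using B(1) that by (simp add: best_trial_def)
    then show ?thesis using T(2) by (rule order_trans)
  qed
  ultimately show ?thesis
    using trial_solution[OF sol B(2) T(1) B(3,4)] solution_change[OF sol B(2)] b
    unfolding best_trial_def by simp
qed

text \<open>The rival's edges at \<open>u\<close> with their slots form a packing at price
  \<open>bud (cs u)\<close>, which is one of the candidates, so their gain is at most
  \<open>best\<close>, and by \<open>best\<close> the total value grows. The terms of vertices in
  \<open>U\<close> can only fall, because \<open>val \<le> bval\<close>.\<close>

lemma best_trial_competitive:
  assumes B: "best_trial U val occ u m ch bval bocc best" "u \<notin> U" and comp: "competitive U val"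
  shows "competitive (insert u U) bval"
  unfolding competitive_def
proof (intro allI impI)
  fix F \<sigma> cs
  assume R: "rival F \<sigma> cs"
  let ?A = "{i \<in> F. lft i = u}" and ?V = "{i. i \<in> F \<and> lft i \<in> U}" and ?p = "bud (cs u)"
  have le: "\<And>f. f < m \<Longrightarrow> val f \<le> bval f" and sum: "(\<Sum>f<m. bval f) = (\<Sum>f<m. val f) + best"
    and best: "\<And>c A \<tau>. c < m \<Longrightarrow> lft c = u \<Longrightarrow> packing u (bud c) (\<lambda>_. 0) A \<tau> \<Longrightarrow> card A \<le> lim u \<Longrightarrow>
        (\<Sum>i\<in>A. bud c - val (\<tau> i)) \<le> best"
    using B(1) unfolding best_trial_def by auto
  have F: "finite F" "\<And>i. i \<in> F \<Longrightarrow> \<sigma> i < m" using R by (auto simp: rival_def intro: finite_subset)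
  \<comment> \<open>If the rival has no edge at \<open>u\<close>, then \<open>cs u\<close> is
    arbitrary and may fail to be an edge at \<open>u\<close>; the sum is empty in that case.\<close>
  have new: "(\<Sum>i\<in>?A. ?p - val (\<sigma> i)) \<le> best"
  proof (cases "?A = {}")
    case False
    then obtain i where "i \<in> F" "lft i = u" by blast
    then have "cs u < m" "lft (cs u) = u" using R by (auto simp: rival_def)
    moreover have "packing u ?p (\<lambda>_. 0) ?A \<sigma>"
      using R by (auto simp: rival_def packing_def eligible_def inj_on_def)
    moreover have "card ?A \<le> lim u" using R by (auto simp: rival_def)
    ultimately show ?thesis by (rule best)
  qed (simp only: sum.empty)
  have "{i. i \<in> F \<and> lft i \<in> insert u U} = ?V \<union> ?A" by auto
  then have "(\<Sum>i | i \<in> F \<and> lft i \<in> insert u U. bud (cs (lft i)) - bval (\<sigma> i)) =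
      (\<Sum>i\<in>?V. bud (cs (lft i)) - bval (\<sigma> i)) + (\<Sum>i\<in>?A. bud (cs (lft i)) - bval (\<sigma> i))"
    using F(1) B(2) by (simp only:) (intro sum.union_disjoint, auto)
  also have "\<dots> \<le> (\<Sum>i\<in>?V. bud (cs (lft i)) - val (\<sigma> i)) + (\<Sum>i\<in>?A. ?p - val (\<sigma> i))"
    using le F(2) by (intro add_mono sum_mono diff_le_mono2) (auto intro: diff_le_mono2)
  also have "\<dots> \<le> (\<Sum>f<m. val f) + best"
    using comp R new by (intro add_mono) (auto simp: competitive_def)
  finally show "(\<Sum>i | i \<in> F \<and> lft i \<in> insert u U. bud (cs (lft i)) - bval (\<sigma> i)) \<le> (\<Sum>f<m. bval f)"
    using sum by simp
qed

end


section \<open>The program\<close>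

text \<open>Cells 0 to 2 hold the three counts; each vertex then takes two cells and each edge
  four.\<close>

definition name :: "(nat \<Rightarrow> nat) \<Rightarrow> nat \<Rightarrow> nat" where
  "name inp k = inp (2 * k + 3)"

definition code :: "(nat \<Rightarrow> nat) \<Rightarrow> nat \<Rightarrow> nat" where
  "code inp k = inp (2 * k + 4)"

definition edge_field :: "nat \<Rightarrow> (nat \<Rightarrow> nat) \<Rightarrow> nat \<Rightarrow> nat" where
  "edge_field d inp i = inp (2 * (inp 0 + inp 1) + 4 * i + (3 + d))"

abbreviation "left \<equiv> edge_field 0"
abbreviation "right \<equiv> edge_field (Suc 0)"
abbreviation "num \<equiv> edge_field 2"
abbreviation "den \<equiv> edge_field 3"

text \<open>Capacity code 0 stands for infinity, any other code for the capacity plus one. With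
  \<open>m\<close> edges in all, infinity may be replaced by \<open>m\<close>.\<close>

definition room :: "nat \<Rightarrow> nat \<Rightarrow> nat" where
  "room m c = (if c = 0 then m else c - 1)"

text \<open>Multiplying all budgets by the product of all denominators makes them natural numbers.\<close>

definition scaled :: "(nat \<Rightarrow> nat) \<Rightarrow> nat \<Rightarrow> nat" where
  "scaled inp i = num inp i * (\<Prod>j\<in>{..<inp 2} - {i}. den inp j)"

abbreviation "reg x \<equiv> Read x (Const 0)"
abbreviation "size_exp k \<equiv> Read ''input'' (Const k)"

text \<open>Constant factors stand on the right, where \<open>small_products\<close> looks for
  them.\<close>

definition name_exp :: "aexp \<Rightarrow> aexp" where
  "name_exp a = Read ''input'' (Add (Mul a (Const 2)) (Const 3))"

definition code_exp :: "aexp \<Rightarrow> aexp" where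
  "code_exp a = Read ''input'' (Add (Mul a (Const 2)) (Const 4))"

definition edge_exp :: "nat \<Rightarrow> aexp \<Rightarrow> aexp" where
  "edge_exp d a = Read ''input''
     (Add (Add (Mul (Add (size_exp 0) (size_exp 1)) (Const 2)) (Mul a (Const 4))) (Const (3 + d)))"

abbreviation "left_exp \<equiv> edge_exp 0"
abbreviation "right_exp \<equiv> edge_exp (Suc 0)"
abbreviation "num_exp \<equiv> edge_exp 2"
abbreviation "den_exp \<equiv> edge_exp 3"

abbreviation neq_exp :: "aexp \<Rightarrow> aexp \<Rightarrow> aexp" where
  "neq_exp a b \<equiv> Add (Sub a b) (Sub b a)"

lemma aval_exps [simp]:
  "aval (name_exp a) s = name (s ''input'') (aval a s)"
  "aval (code_exp a) s = code (s ''input'') (aval a s)"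
  "aval (edge_exp d a) s = edge_field d (s ''input'') (aval a s)"
  by (simp_all add: name_exp_def code_exp_def edge_exp_def name_def code_def edge_field_def mult.commute)

text \<open>The arrays \<open>val\<close>, \<open>occ\<close> hold the committed allocation of slots, \<open>tval\<close>, \<open>tocc\<close> the one
  that results from the price on trial, and \<open>bval\<close>, \<open>bocc\<close> the best one found for the current vertex.\<close>

definition set_capacities :: prog where
  "set_capacities = Loop ''k'' 1
     (Branch (code_exp (Add (size_exp 0) (reg ''k'')))
       (Assign ''rem'' (name_exp (Add (size_exp 0) (reg ''k'')))
         (Sub (code_exp (Add (size_exp 0) (reg ''k''))) (Const 1)))
       (Assign ''rem'' (name_exp (Add (size_exp 0) (reg ''k''))) (size_exp 2)))"

text \<open>The edges listed first at a right vertex become its slots until the capacity is spent,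
  so there are never more slots than edges, however large the capacity.\<close>

definition set_slots :: prog where
  "set_slots = Loop ''f'' 2
     (Branch (Read ''rem'' (right_exp (reg ''f'')))
       (Assign ''active'' (reg ''f'') (Const 1) ;;
        Assign ''rem'' (right_exp (reg ''f'')) (Sub (Read ''rem'' (right_exp (reg ''f''))) (Const 1)))
       (Assign ''active'' (reg ''f'') (Const 0)))"

text \<open>As there is no division, the product of the other denominators is built factor by
  factor; each factor is an input cell, as \<open>small_products\<close> requires.\<close>

definition set_budgets :: prog where
  "set_budgets = Loop ''i'' 2
     (Assign ''budget'' (reg ''i'') (num_exp (reg ''i'')) ;;
      Loop ''j'' 2
       (Branch (neq_exp (reg ''i'') (reg ''j''))
         (Assign ''budget'' (reg ''i'') (Mul (Read ''budget'' (reg ''i'')) (den_exp (reg ''j''))))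
         Nop))"

definition scan_slots :: prog where
  "scan_slots = Loop ''f'' 2
     (Branch (Read ''active'' (reg ''f''))
       (Branch (neq_exp (right_exp (reg ''f'')) (right_exp (reg ''i''))) Nop
         (Branch (Sub (Sub (reg ''p'') (Read ''tval'' (reg ''f''))) (reg ''g''))
           (Assign ''g'' (Const 0) (Sub (reg ''p'') (Read ''tval'' (reg ''f''))) ;;
            Assign ''bi'' (Const 0) (reg ''i'') ;;
            Assign ''bf'' (Const 0) (reg ''f''))
           Nop))
       Nop)"

definition pick :: prog where
  "pick = Assign ''g'' (Const 0) (Const 0) ;;
     Loop ''i'' 2
       (Branch (neq_exp (left_exp (reg ''i'')) (reg ''u'')) Nop
         (Branch (Sub (reg ''p'') (Read ''budget'' (reg ''i''))) Nop
           (Branch (Read ''used'' (reg ''i'')) Nop scan_slots)))"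

text \<open>Overwriting the slot is the whole eviction, since sales are recorded only at
  slots.\<close>

definition augment :: prog where
  "augment = pick ;;
     Branch (reg ''g'')
       (Assign ''gain'' (Const 0) (Add (reg ''gain'') (reg ''g'')) ;;
        Assign ''used'' (reg ''bi'') (Const 1) ;;
        Assign ''tval'' (reg ''bf'') (reg ''p'') ;;
        Assign ''tocc'' (reg ''bf'') (Add (reg ''bi'') (Const 1)))
       Nop"

text \<open>As many rounds as edges are enough whatever the limit, because an edge is placed at most
  once per trial.\<close>

definition try_price :: prog where
  "try_price = Assign ''gain'' (Const 0) (Const 0) ;;
     Loop ''f'' 2
       (Assign ''tval'' (reg ''f'') (Read ''val'' (reg ''f'')) ;;
        Assign ''tocc'' (reg ''f'') (Read ''occ'' (reg ''f'')) ;;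
        Assign ''used'' (reg ''f'') (Const 0)) ;;
     Loop ''r'' 2 (Branch (Sub (reg ''limit'') (reg ''r'')) augment Nop)"

definition try_edge :: prog where
  "try_edge = Assign ''p'' (Const 0) (Read ''budget'' (reg ''c'')) ;;
     try_price ;;
     Branch (Sub (reg ''gain'') (reg ''best''))
       (Assign ''best'' (Const 0) (reg ''gain'') ;;
        Assign ''choice'' (reg ''u'') (Add (reg ''c'') (Const 1)) ;;
        Loop ''f'' 2
         (Assign ''bval'' (reg ''f'') (Read ''tval'' (reg ''f'')) ;;
          Assign ''bocc'' (reg ''f'') (Read ''tocc'' (reg ''f''))))
       Nop"

definition serve :: prog where
  "serve = Assign ''u'' (Const 0) (name_exp (reg ''k'')) ;;
     Branch (code_exp (reg ''k''))
       (Assign ''limit'' (Const 0) (Sub (code_exp (reg ''k'')) (Const 1)))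
       (Assign ''limit'' (Const 0) (size_exp 2)) ;;
     Assign ''best'' (Const 0) (Const 0) ;;
     Assign ''choice'' (reg ''u'') (Const 0) ;;
     Loop ''f'' 2
       (Assign ''bval'' (reg ''f'') (Read ''val'' (reg ''f'')) ;;
        Assign ''bocc'' (reg ''f'') (Read ''occ'' (reg ''f''))) ;;
     Loop ''c'' 2 (Branch (neq_exp (left_exp (reg ''c'')) (reg ''u'')) Nop try_edge) ;;
     Loop ''f'' 2
       (Assign ''val'' (reg ''f'') (Read ''bval'' (reg ''f'')) ;;
        Assign ''occ'' (reg ''f'') (Read ''bocc'' (reg ''f'')))"

definition greedy :: prog where
  "greedy = Loop ''k'' 0 serve"

text \<open>Copying numerator and denominator from the input yields a price in lowest terms, as
  \<open>encode_rat\<close> demands, without computing common divisors. The price zero is written as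
  \<open>0\<close> over \<open>1\<close>.\<close>

definition write_prices :: prog where
  "write_prices =
     Loop ''k'' 0
       (Branch (Read ''choice'' (name_exp (reg ''k'')))
         (Assign ''output'' (Mul (reg ''k'') (Const 2))
            (num_exp (Sub (Read ''choice'' (name_exp (reg ''k''))) (Const 1))) ;;
          Assign ''output'' (Add (Mul (reg ''k'') (Const 2)) (Const 1))
            (den_exp (Sub (Read ''choice'' (name_exp (reg ''k''))) (Const 1))))
         (Assign ''output'' (Mul (reg ''k'') (Const 2)) (Const 0) ;;
          Assign ''output'' (Add (Mul (reg ''k'') (Const 2)) (Const 1)) (Const 1))) ;;
     Loop ''k'' 1
       (Assign ''output'' (Mul (Add (size_exp 0) (reg ''k'')) (Const 2)) (Const 0) ;;
        Assign ''output'' (Add (Mul (Add (size_exp 0) (reg ''k'')) (Const 2)) (Const 1)) (Const 1))"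

text \<open>The second loop visits slots rather than edges, so the flags of all edges are cleared
  beforehand.\<close>

definition write_edges :: prog where
  "write_edges =
     Loop ''i'' 2
       (Assign ''output'' (Add (Mul (Add (size_exp 0) (size_exp 1)) (Const 2)) (reg ''i'')) (Const 0)) ;;
     Loop ''f'' 2
       (Branch (Read ''occ'' (reg ''f''))
         (Assign ''output''
           (Add (Mul (Add (size_exp 0) (size_exp 1)) (Const 2)) (Sub (Read ''occ'' (reg ''f'')) (Const 1)))
           (Const 1))
         Nop) ;;
     Assign ''output_length'' (Const 0) (Add (Mul (Add (size_exp 0) (size_exp 1)) (Const 2)) (size_exp 2))"

definition pricing_prog :: prog where
  "pricing_prog = set_capacities ;; set_slots ;; set_budgets ;; greedy ;; write_prices ;; write_edges"

lemma writes_progs [simp]: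
  "writes set_capacities = {''k'', ''rem''}"
  "writes set_slots = {''f'', ''active'', ''rem''}"
  "writes set_budgets = {''i'', ''j'', ''budget''}"
  "writes scan_slots = {''f'', ''g'', ''bi'', ''bf''}"
  "writes pick = {''i'', ''f'', ''g'', ''bi'', ''bf''}"
  "writes augment = {''i'', ''f'', ''g'', ''bi'', ''bf'', ''gain'', ''used'', ''tval'', ''tocc''}"
  "writes try_price =
     {''i'', ''f'', ''g'', ''bi'', ''bf'', ''gain'', ''used'', ''tval'', ''tocc'', ''r''}"
  "writes try_edge = {''i'', ''f'', ''g'', ''bi'', ''bf'', ''gain'', ''used'', ''tval'', ''tocc'', ''r'',
     ''p'', ''best'', ''choice'', ''bval'', ''bocc''}"
  "writes serve = {''i'', ''f'', ''g'', ''bi'', ''bf'', ''gain'', ''used'', ''tval'', ''tocc'', ''r'',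
     ''p'', ''best'', ''choice'', ''bval'', ''bocc'', ''c'', ''u'', ''limit'', ''val'', ''occ''}"
  "writes greedy = {''i'', ''f'', ''g'', ''bi'', ''bf'', ''gain'', ''used'', ''tval'', ''tocc'', ''r'',
     ''p'', ''best'', ''choice'', ''bval'', ''bocc'', ''c'', ''u'', ''limit'', ''val'', ''occ'', ''k''}"
  "writes write_prices = {''k'', ''output''}"
  "writes write_edges = {''i'', ''f'', ''output'', ''output_length''}"
proof -
  show *: "writes scan_slots = {''f'', ''g'', ''bi'', ''bf''}"
    by (auto simp: scan_slots_def)
  show p: "writes pick = {''i'', ''f'', ''g'', ''bi'', ''bf''}"
    by (auto simp: pick_def *)
  show r: "writes augment = {''i'', ''f'', ''g'', ''bi'', ''bf'', ''gain'', ''used'', ''tval'', ''tocc''}"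
    by (auto simp: augment_def p)
  show t: "writes try_price =
     {''i'', ''f'', ''g'', ''bi'', ''bf'', ''gain'', ''used'', ''tval'', ''tocc'', ''r''}"
    by (auto simp: try_price_def r)
  show e: "writes try_edge = {''i'', ''f'', ''g'', ''bi'', ''bf'', ''gain'', ''used'', ''tval'', ''tocc'', ''r'',
     ''p'', ''best'', ''choice'', ''bval'', ''bocc''}"
    by (auto simp: try_edge_def t)
  show s: "writes serve = {''i'', ''f'', ''g'', ''bi'', ''bf'', ''gain'', ''used'', ''tval'', ''tocc'', ''r'',
     ''p'', ''best'', ''choice'', ''bval'', ''bocc'', ''c'', ''u'', ''limit'', ''val'', ''occ''}"
    by (auto simp: serve_def e)
  show "writes greedy = {''i'', ''f'', ''g'', ''bi'', ''bf'', ''gain'', ''used'', ''tval'', ''tocc'', ''r'',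
     ''p'', ''best'', ''choice'', ''bval'', ''bocc'', ''c'', ''u'', ''limit'', ''val'', ''occ'', ''k''}"
    by (auto simp: greedy_def s)
qed (auto simp: set_capacities_def set_slots_def set_budgets_def write_prices_def write_edges_def)

lemma tame_pricing_prog: "tame pricing_prog"
proof -
  have e: "small_products (name_exp a)" "small_products (code_exp a)" "small_products (edge_exp d a)"
    if "small_products a" for a d
    using that by (simp_all add: name_exp_def code_exp_def edge_exp_def)
  \<comment> \<open>This admits the product in \<open>set_budgets\<close>: its second factor reads
    the input array.\<close>
  have m: "small_products (Mul a (edge_exp d b))" if "small_products a" "small_products b" for a b d
    using that by (simp add: edge_exp_def)
  have 1: "tame set_capacities" "tame set_slots" "tame set_budgets" "tame write_prices" "tame write_edges"
    by (simp_all add: set_capacities_def set_slots_def set_budgets_def write_prices_def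
        write_edges_def e m)
  have 2: "tame scan_slots" by (simp add: scan_slots_def e)
  have 3: "tame pick" by (simp add: pick_def e 2)
  have 4: "tame augment" by (simp add: augment_def 3)
  have 5: "tame try_price" by (simp add: try_price_def 4)
  have 6: "tame try_edge" by (simp add: try_edge_def 5)
  have 7: "tame serve" by (simp add: serve_def 6 e)
  have "tame greedy" by (simp add: greedy_def 7)
  with 1 show ?thesis by (simp add: pricing_prog_def)
qed


section \<open>Correctness of the program\<close>

lemma run_set_budgets:
  assumes "s ''input'' = inp"
  shows "\<forall>i<inp 2. run set_budgets s ''budget'' i = scaled inp i"
proof -
  let ?I = "\<lambda>i t. t ''input'' = inp \<and> (\<forall>i'<i. t ''budget'' i' = scaled inp i')"
  let ?body = "Assign ''budget'' (reg ''i'') (num_exp (reg ''i'')) ;;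
      Loop ''j'' 2
       (Branch (neq_exp (reg ''i'') (reg ''j''))
         (Assign ''budget'' (reg ''i'') (Mul (Read ''budget'' (reg ''i'')) (den_exp (reg ''j''))))
         Nop)"
  have "?I (inp 2) (run (Loop ''i'' 2 ?body) s)"
  proof (induction rule: run_Loop_induct[where I = ?I])
    case (step i t)
    let ?J = "\<lambda>j t. t ''input'' = inp \<and> t ''i'' 0 = i \<and> (\<forall>i'<i. t ''budget'' i' = scaled inp i') \<and>
      t ''budget'' i = num inp i * (\<Prod>j'\<in>{..<j} - {i}. den inp j')"
    define t' where "t' = run (Assign ''budget'' (reg ''i'') (num_exp (reg ''i''))) t"
    have "?J (inp 2) (run (Loop ''j'' 2
       (Branch (neq_exp (reg ''i'') (reg ''j''))
         (Assign ''budget'' (reg ''i'') (Mul (Read ''budget'' (reg ''i'')) (den_exp (reg ''j''))))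
         Nop)) t')"
    proof (induction rule: run_Loop_induct[where I = ?J])
      case (step j r)
      then show ?case by (auto simp: lessThan_Suc insert_Diff_if algebra_simps)
    qed (use step in \<open>auto simp: t'_def\<close>)
    then show ?case by (auto simp: t'_def less_Suc_eq scaled_def)
  qed (use assms in auto)
  then show ?thesis by (simp add: set_budgets_def)
qed

lemma run_set_capacities:
  assumes "s ''input'' = inp" and inj: "inj_on (\<lambda>k. name inp (inp 0 + k)) {..<inp 1}"
  shows "\<forall>k<inp 1. run set_capacities s ''rem'' (name inp (inp 0 + k)) =
    room (inp 2) (code inp (inp 0 + k))"
proof -
  let ?I = "\<lambda>k t. t ''input'' = inp \<and> k \<le> inp 1 \<and>
    (\<forall>k'<k. t ''rem'' (name inp (inp 0 + k')) = room (inp 2) (code inp (inp 0 + k')))"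
  have "?I (inp 1) (run set_capacities s)"
    unfolding set_capacities_def
  proof (induction rule: run_Loop_induct[where I = ?I])
    case (step k t)
    have "name inp (inp 0 + k') \<noteq> name inp (inp 0 + k)" if "k' < k" for k'
      using inj_onD[OF inj, of k' k] that step by auto
    then show ?case using step(1-3) by (auto simp: less_Suc_eq room_def)
  qed (use assms in auto)
  then show ?thesis by simp
qed

text \<open>At every moment the active edges at \<open>v\<close> and the remaining room of
  \<open>v\<close> add up to the initial room. In the end either the room is exhausted or no edge at
  \<open>v\<close> was ever refused.\<close>

lemma run_set_slots:
  assumes "s ''input'' = inp"
  defines "act \<equiv> \<lambda>f. run set_slots s ''active'' f \<noteq> 0"
  shows "card {f. f < inp 2 \<and> act f \<and> right inp f = v} \<le> s ''rem'' v"
    and "card {f. f < inp 2 \<and> act f \<and> right inp f = v} = s ''rem'' v \<or>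
      (\<forall>f<inp 2. right inp f = v \<longrightarrow> act f)"
proof -
  let ?A = "\<lambda>t n. {f. f < n \<and> t ''active'' f \<noteq> 0 \<and> right inp f = v}"
  let ?I = "\<lambda>n t. t ''input'' = inp \<and> card (?A t n) + t ''rem'' v = s ''rem'' v \<and>
    (t ''rem'' v = 0 \<or> (\<forall>f<n. right inp f = v \<longrightarrow> t ''active'' f \<noteq> 0))"
  have "?I (inp 2) (run set_slots s)"
    unfolding set_slots_def
  proof (induction rule: run_Loop_induct[where I = ?I])
    case (step n t)
    let ?body = "Branch (Read ''rem'' (right_exp (reg ''f'')))
       (Assign ''active'' (reg ''f'') (Const 1) ;;
        Assign ''rem'' (right_exp (reg ''f'')) (Sub (Read ''rem'' (right_exp (reg ''f''))) (Const 1)))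
       (Assign ''active'' (reg ''f'') (Const 0))"
    let ?t = "(run ?body t)(''f'' := (run ?body t ''f'')(0 := Suc n))"
    have I: "t ''input'' = inp" "card (?A t n) + t ''rem'' v = s ''rem'' v"
      "t ''rem'' v = 0 \<or> (\<forall>f<n. right inp f = v \<longrightarrow> t ''active'' f \<noteq> 0)" and n: "t ''f'' 0 = n"
      using step by auto
    have fin: "finite (?A t n)" by simp
    have old: "?t ''active'' f = t ''active'' f" if "f < n" for f using that n by simp
    have new: "?t ''active'' n = (if t ''rem'' (right inp n) = 0 then 0 else 1)"
      using I(1) n by simp
    have rem: "?t ''rem'' v = (if right inp n = v then t ''rem'' v - 1 else t ''rem'' v)"
      using I(1) n by simp
    have A: "?A ?t (Suc n) =
        (if right inp n = v \<and> t ''rem'' v \<noteq> 0 then insert n (?A t n) else ?A t n)"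
      using old new by (auto simp: less_Suc_eq simp del: run.simps fun_upd_apply split: if_splits)
    have "card (?A ?t (Suc n)) + ?t ''rem'' v = s ''rem'' v"
      unfolding A rem using I(2) fin by (simp add: card_insert_if)
    moreover have "?t ''rem'' v = 0 \<or> (\<forall>f<Suc n. right inp f = v \<longrightarrow> ?t ''active'' f \<noteq> 0)"
      using I(3) old new unfolding rem
      by (auto simp: less_Suc_eq simp del: run.simps fun_upd_apply split: if_splits)
    moreover have "?t ''input'' = inp" using I(1) by simp
    ultimately show ?case by blast
  qed (use assms in auto)
  then show "card {f. f < inp 2 \<and> act f \<and> right inp f = v} \<le> s ''rem'' v"
    and "card {f. f < inp 2 \<and> act f \<and> right inp f = v} = s ''rem'' v \<or>
      (\<forall>f<inp 2. right inp f = v \<longrightarrow> act f)"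
    unfolding act_def by auto
qed

locale greedy_run =
  fixes inp :: "nat \<Rightarrow> nat" and act :: "nat \<Rightarrow> bool" and lim :: "nat \<Rightarrow> nat"
begin

sublocale slots "inp 2" "left inp" "right inp" "scaled inp" act lim .

section \<open>Finding the most profitable pair of edge and slot\<close>

definition ready :: "state \<Rightarrow> bool" where
  "ready s \<longleftrightarrow> s ''input'' = inp \<and> (\<forall>f<inp 2. s ''active'' f \<noteq> 0 \<longleftrightarrow> act f) \<and>
     (\<forall>i<inp 2. s ''budget'' i = scaled inp i)"

text \<open>Pairs are scanned in lexicographic order, and those before \<open>(i, f)\<close> are
  done. If \<open>g\<close> is zero, no pair with positive gain has been met and \<open>bi\<close>,
  \<open>bf\<close> carry no meaning.\<close>

definition best_pair :: "nat \<Rightarrow> nat \<Rightarrow> state \<Rightarrow> bool" where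
  "best_pair i f t \<longleftrightarrow>
     (\<forall>i' f'. eligible (t ''u'' 0) (t ''p'' 0) (t ''used'') i' f' \<longrightarrow> i' < i \<or> i' = i \<and> f' < f \<longrightarrow>
        t ''p'' 0 - t ''tval'' f' \<le> t ''g'' 0) \<and>
     (t ''g'' 0 \<noteq> 0 \<longrightarrow>
        eligible (t ''u'' 0) (t ''p'' 0) (t ''used'') (t ''bi'' 0) (t ''bf'' 0) \<and>
        t ''g'' 0 = t ''p'' 0 - t ''tval'' (t ''bf'' 0))"

lemma ready_frame:
  "ready s \<Longrightarrow> t ''input'' = s ''input'' \<Longrightarrow> t ''active'' = s ''active'' \<Longrightarrow>
    t ''budget'' = s ''budget'' \<Longrightarrow> ready t"
  unfolding ready_def by simp

lemma best_pair_skip: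
  assumes "best_pair i f t"
    and "t' ''u'' = t ''u''" "t' ''p'' = t ''p''" "t' ''used'' = t ''used''" "t' ''tval'' = t ''tval''"
    and "t' ''g'' = t ''g''" "t' ''bi'' = t ''bi''" "t' ''bf'' = t ''bf''"
    and "eligible (t ''u'' 0) (t ''p'' 0) (t ''used'') i f \<longrightarrow> t ''p'' 0 - t ''tval'' f \<le> t ''g'' 0"
  shows "best_pair i (Suc f) t'"
  using assms(1,9) unfolding best_pair_def assms(2-8) less_Suc_eq by blast

lemma best_pair_take:
  assumes B: "best_pair i f t"
    and eq: "t' ''u'' = t ''u''" "t' ''p'' = t ''p''" "t' ''used'' = t ''used''" "t' ''tval'' = t ''tval''"
    and new: "t' ''g'' 0 = t ''p'' 0 - t ''tval'' f" "t' ''bi'' 0 = i" "t' ''bf'' 0 = f"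
    and el: "eligible (t ''u'' 0) (t ''p'' 0) (t ''used'') i f"
    and gt: "t ''g'' 0 < t ''p'' 0 - t ''tval'' f"
  shows "best_pair i (Suc f) t'"
  unfolding best_pair_def eq new
proof (intro conjI allI impI)
  fix i' f'
  assume e: "eligible (t ''u'' 0) (t ''p'' 0) (t ''used'') i' f'" and "i' < i \<or> i' = i \<and> f' < Suc f"
  then consider "i' < i \<or> i' = i \<and> f' < f" | "f' = f" by linarith
  then show "t ''p'' 0 - t ''tval'' f' \<le> t ''p'' 0 - t ''tval'' f"
  proof cases
    case 1
    with B e have "t ''p'' 0 - t ''tval'' f' \<le> t ''g'' 0" unfolding best_pair_def by blast
    with gt show ?thesis by linarith
  qed simp
qed (use el in simp_all)

lemma run_scan_slots:
  assumes "ready s" "best_pair i 0 s" "s ''i'' 0 = i" "i < inp 2" "left inp i = s ''u'' 0"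
    "s ''p'' 0 \<le> scaled inp i" "s ''used'' i = 0"
  shows "best_pair i (inp 2) (run scan_slots s)"
proof -
  let ?I = "\<lambda>f t. ready t \<and> t ''i'' 0 = i \<and> left inp i = t ''u'' 0 \<and> t ''p'' 0 \<le> scaled inp i \<and>
    t ''used'' i = 0 \<and> best_pair i f t"
  have "?I (inp 2) (run scan_slots s)"
    unfolding scan_slots_def
  proof (induction rule: run_Loop_induct[where I = ?I])
    case (step f t)
    have r: "ready t" "t ''input'' = inp" "t ''i'' 0 = i" "t ''f'' 0 = f" "f < inp 2"
      "t ''active'' f = 0 \<longleftrightarrow> \<not> act f"
      "left inp i = t ''u'' 0" "t ''p'' 0 \<le> scaled inp i" "t ''used'' i = 0" and B: "best_pair i f t"
      using step(1-3) by (auto simp: ready_def)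
    have el: "eligible (t ''u'' 0) (t ''p'' 0) (t ''used'') i f \<longleftrightarrow> act f \<and> right inp f = right inp i"
      using r assms(4) by (auto simp: eligible_def)
    have "ready (t(''f'' := (t ''f'')(0 := Suc f)))" "ready (t(''g'' := x, ''bi'' := y, ''bf'' := z, ''f'' := w))"
      for x y z w
      using r(1) by (simp_all add: ready_def)
    moreover have "best_pair i (Suc f) (t(''f'' := (t ''f'')(0 := Suc f)))"
      if "\<not> (act f \<and> right inp f = right inp i \<and> t ''g'' 0 < t ''p'' 0 - t ''tval'' f)"
      using that el by (intro best_pair_skip[OF B]) auto
    moreover have "best_pair i (Suc f) (t(''g'' := (t ''g'')(0 := t ''p'' 0 - t ''tval'' f),
        ''bi'' := (t ''bi'')(0 := i), ''bf'' := (t ''bf'')(0 := f), ''f'' := (t ''f'')(0 := Suc f)))"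
      if "act f" "right inp f = right inp i" "t ''g'' 0 < t ''p'' 0 - t ''tval'' f"
      using that el by (intro best_pair_take[OF B]) auto
    ultimately show ?case using r by auto
  qed (use assms in \<open>auto simp: ready_def best_pair_def\<close>)
  then show ?thesis by simp
qed


text \<open>A row is finished when all slots were scanned or when edge \<open>i\<close> cannot be
  placed in any slot, in which case the program skips the scan.\<close>

lemma best_pair_row:
  assumes "best_pair i f t" "t' ''u'' = t ''u''" "t' ''p'' = t ''p''" "t' ''used'' = t ''used''"
    "t' ''tval'' = t ''tval''" "t' ''g'' = t ''g''" "t' ''bi'' = t ''bi''" "t' ''bf'' = t ''bf''"
    and "f = inp 2 \<or> \<not> (\<exists>f'. eligible (t ''u'' 0) (t ''p'' 0) (t ''used'') i f')"
  shows "best_pair (Suc i) 0 t'"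
proof -
  have "i' < i \<or> i' = i \<and> f' < f"
    if "eligible (t ''u'' 0) (t ''p'' 0) (t ''used'') i' f'" "i' < Suc i" for i' f'
    using that assms(9) by (auto simp: less_Suc_eq eligible_def)
  then show ?thesis
    using assms(1) unfolding best_pair_def assms(2-8) by blast
qed

lemma run_pick:
  assumes "ready s"
  defines "t \<equiv> run pick s"
  shows "eligible (s ''u'' 0) (s ''p'' 0) (s ''used'') i f \<Longrightarrow> s ''p'' 0 - s ''tval'' f \<le> t ''g'' 0"
    and "t ''g'' 0 \<noteq> 0 \<Longrightarrow> eligible (s ''u'' 0) (s ''p'' 0) (s ''used'') (t ''bi'' 0) (t ''bf'' 0) \<and>
      t ''g'' 0 = s ''p'' 0 - s ''tval'' (t ''bf'' 0)"
proof -
  let ?s = "run (Assign ''g'' (Const 0) (Const 0)) s"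
  let ?body = "Branch (neq_exp (left_exp (reg ''i'')) (reg ''u'')) Nop
         (Branch (Sub (reg ''p'') (Read ''budget'' (reg ''i''))) Nop
           (Branch (Read ''used'' (reg ''i'')) Nop scan_slots))"
  let ?I = "\<lambda>i t. ready t \<and> best_pair i 0 t"
  have "?I (inp 2) (run (Loop ''i'' 2 ?body) ?s)"
  proof (induction rule: run_Loop_induct[where I = ?I])
    case (step i t)
    have B: "best_pair i 0 t" and R: "ready t" and r: "t ''input'' = inp" "t ''i'' 0 = i"
      "t ''budget'' i = scaled inp i" and i: "i < inp 2"
      using step(1-3) by (auto simp: ready_def)
    define P where "P \<longleftrightarrow> left inp i = t ''u'' 0 \<and> t ''p'' 0 \<le> scaled inp i \<and> t ''used'' i = 0"
    have b: "run ?body t = (if P then run scan_slots t else t)"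
      using r by (auto simp: P_def)
    show ?case
    proof (cases P)
      case True
      have "best_pair i (inp 2) (run scan_slots t)"
        using True by (intro run_scan_slots[OF R B r(2) i]) (simp_all add: P_def)
      then show ?thesis using True R unfolding b
        by (auto simp: run_frame intro!: best_pair_row ready_frame[OF R])
    next
      case False
      then have "\<not> (\<exists>f'. eligible (t ''u'' 0) (t ''p'' 0) (t ''used'') i f')"
        by (auto simp: P_def eligible_def)
      then show ?thesis using False R B unfolding b
        by (auto simp: run_frame intro!: best_pair_row ready_frame[OF R])
    qed
  qed (use assms in \<open>auto simp: ready_def best_pair_def\<close>)
  then have *: "best_pair (inp 2) 0 t" by (simp add: t_def pick_def)
  have eq: "t ''u'' = s ''u''" "t ''p'' = s ''p''" "t ''used'' = s ''used''" "t ''tval'' = s ''tval''"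
    by (simp_all add: t_def run_frame)
  show "s ''p'' 0 - s ''tval'' f \<le> t ''g'' 0" if e: "eligible (s ''u'' 0) (s ''p'' 0) (s ''used'') i f"
  proof -
    have "i < inp 2" using e by (simp add: eligible_def)
    with * e show ?thesis unfolding best_pair_def eq by blast
  qed
  show "t ''g'' 0 \<noteq> 0 \<Longrightarrow> eligible (s ''u'' 0) (s ''p'' 0) (s ''used'') (t ''bi'' 0) (t ''bf'' 0) \<and>
      t ''g'' 0 = s ''p'' 0 - s ''tval'' (t ''bf'' 0)"
    using * unfolding best_pair_def eq by blast
qed

section \<open>From a single price to all left vertices\<close>

definition trying :: "nat set \<Rightarrow> nat \<Rightarrow> nat \<Rightarrow> state \<Rightarrow> bool" where
  "trying U p r t \<longleftrightarrow> ready t \<and> solution U (t ''choice'') (t ''val'') (t ''occ'') \<and>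
     t ''u'' 0 \<notin> U \<and> t ''limit'' 0 = lim (t ''u'' 0) \<and> t ''p'' 0 = p \<and>
     trial (t ''u'' 0) p (t ''val'') (t ''occ'') r
       (t ''tval'') (t ''tocc'') (t ''used'') (t ''gain'' 0)"

lemma run_augment:
  assumes "trying U p r s" "r < lim (s ''u'' 0)"
  shows "trying U p (Suc r) (run augment s)"
proof -
  let ?t = "run pick s"
  have R: "ready s" and sol: "solution U (s ''choice'') (s ''val'') (s ''occ'')" "s ''u'' 0 \<notin> U"
    and l: "s ''limit'' 0 = lim (s ''u'' 0)" "s ''p'' 0 = p"
    and T: "trial (s ''u'' 0) p (s ''val'') (s ''occ'') r (s ''tval'') (s ''tocc'') (s ''used'') (s ''gain'' 0)"
    using assms(1) by (auto simp: trying_def)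
  note pick = run_pick[OF R]
  have Rt: "ready ?t" by (rule ready_frame[OF R]) (simp_all add: run_frame)
  show ?thesis
  proof (cases "?t ''g'' 0 = 0")
    case True
    \<comment> \<open>As subtraction is truncated, zero gain everywhere means that no eligible slot
      is worth less than \<open>p\<close>.\<close>
    then have "\<forall>i f. eligible (s ''u'' 0) p (s ''used'') i f \<longrightarrow> p \<le> s ''tval'' f"
      using pick(1) l(2) by fastforce
    then have "trial (s ''u'' 0) p (s ''val'') (s ''occ'') (Suc r) (s ''tval'') (s ''tocc'') (s ''used'') (s ''gain'' 0)"
      by (intro trial_idle[OF T]) blast
    moreover have "run augment s = ?t" using True by (simp add: augment_def)
    ultimately show ?thesis using Rt sol l by (simp add: trying_def run_frame)
  next
    case False
    define i f where "i = ?t ''bi'' 0" and "f = ?t ''bf'' 0"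
    have e: "eligible (s ''u'' 0) p (s ''used'') i f" and g: "?t ''g'' 0 = p - s ''tval'' f"
      using pick(2)[OF False] l(2) by (auto simp: i_def f_def)
    have "trial (s ''u'' 0) p (s ''val'') (s ''occ'') (Suc r) ((s ''tval'')(f := p))
        ((s ''tocc'')(f := Suc i)) ((s ''used'')(i := 1)) (s ''gain'' 0 + (p - s ''tval'' f))"
    proof (rule trial_step[OF sol T assms(2) e])
      show "s ''tval'' f < p" using g False by simp
      show "p - s ''tval'' f' \<le> p - s ''tval'' f" if "eligible (s ''u'' 0) p (s ''used'') i' f'" for i' f'
        using pick(1)[of i' f'] that l(2) g by simp
    qed
    moreover have "run augment s = ?t(''gain'' := (s ''gain'')(0 := s ''gain'' 0 + (p - s ''tval'' f)),
        ''used'' := (s ''used'')(i := 1), ''tval'' := (s ''tval'')(f := p),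
        ''tocc'' := (s ''tocc'')(f := Suc i))"
      using False g l(2) by (simp add: augment_def i_def f_def run_frame)
    ultimately show ?thesis
      using sol l ready_frame[OF R] by (simp add: trying_def run_frame)
  qed
qed

lemma run_try_price:
  assumes R: "ready s" and sol: "solution U (s ''choice'') (s ''val'') (s ''occ'')" "s ''u'' 0 \<notin> U"
    and l: "s ''limit'' 0 = lim (s ''u'' 0)"
  shows "trying U (s ''p'' 0) (inp 2) (run try_price s)"
proof -
  let ?s = "run (Assign ''gain'' (Const 0) (Const 0)) s"
  let ?copy = "Assign ''tval'' (reg ''f'') (Read ''val'' (reg ''f'')) ;;
        Assign ''tocc'' (reg ''f'') (Read ''occ'' (reg ''f'')) ;;
        Assign ''used'' (reg ''f'') (Const 0)"
  define t where "t = run (Loop ''f'' 2 ?copy) ?s"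
  let ?I = "\<lambda>n t. (\<forall>f<n. t ''tval'' f = t ''val'' f \<and> t ''tocc'' f = t ''occ'' f \<and> t ''used'' f = 0)"
  have in2: "?s ''input'' 2 = inp 2" using R by (simp add: ready_def)
  have "?I (inp 2) t"
    unfolding t_def
  proof (induction rule: run_Loop_induct[where I = ?I])
    case (step f t)
    then show ?case by (simp add: less_Suc_eq)
  qed (use in2 in simp_all)
  then have copied: "\<And>f. f < inp 2 \<Longrightarrow> t ''tval'' f = t ''val'' f"
    "\<And>f. f < inp 2 \<Longrightarrow> t ''tocc'' f = t ''occ'' f" "\<And>f. f < inp 2 \<Longrightarrow> t ''used'' f = 0" by auto
  have fr: "t y = s y" if "y \<notin> {''gain'', ''f'', ''tval'', ''tocc'', ''used''}" for y
    using run_frame[of y "Loop ''f'' 2 ?copy" ?s] that by (simp add: t_def)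
  have g: "t ''gain'' 0 = 0"
    using run_frame[of "''gain''" "Loop ''f'' 2 ?copy" ?s] by (simp add: t_def)
  have "ready t" by (rule ready_frame[OF R]) (simp_all add: fr)
  moreover have "solution U (t ''choice'') (t ''val'') (t ''occ'')"
    using sol(1) by (simp add: fr)
  note trial_init[OF this copied, where u = "s ''u'' 0" and p = "s ''p'' 0"]
  ultimately have start: "trying U (s ''p'' 0) 0 t"
    unfolding trying_def using sol l g by (simp add: fr)
  let ?J = "\<lambda>r t. trying U (s ''p'' 0) r t"
  have "?J (inp 2) (run (Loop ''r'' 2 (Branch (Sub (reg ''limit'') (reg ''r'')) augment Nop)) t)"
  proof (induction rule: run_Loop_induct[where I = ?J])
    case init
    show ?case using start by (simp add: trying_def ready_def)
  next
    case (step r t)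
    have lt: "t ''limit'' 0 = lim (t ''u'' 0)" using step(2) by (simp add: trying_def)
    show ?case
    proof (cases "r < lim (t ''u'' 0)")
      case True
      then have "trying U (s ''p'' 0) (Suc r) (run augment t)" by (intro run_augment step(2))
      then show ?thesis using True lt step(3) by (simp add: trying_def ready_def)
    next
      case False
      then have "trial (t ''u'' 0) (s ''p'' 0) (t ''val'') (t ''occ'') (Suc r)
          (t ''tval'') (t ''tocc'') (t ''used'') (t ''gain'' 0)"
        using step(2) by (intro trial_idle) (auto simp: trying_def)
      then show ?thesis using False lt step(2,3) by (simp add: trying_def ready_def)
    qed
  next
    case bound
    show ?case using fr[of "''input''"] R by (simp add: ready_def del: run.simps)
  qed simp
  then show ?thesis by (simp add: try_price_def t_def)
qed

definition searching :: "nat set \<Rightarrow> nat \<Rightarrow> nat \<Rightarrow> state \<Rightarrow> bool" where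
  "searching U u c t \<longleftrightarrow> ready t \<and> t ''u'' 0 = u \<and> t ''limit'' 0 = lim u \<and>
     best_trial U (t ''val'') (t ''occ'') u c (t ''choice'') (t ''bval'') (t ''bocc'') (t ''best'' 0)"

lemma run_try_edge:
  assumes S: "searching U u c s" and u: "u \<notin> U" and c: "s ''c'' 0 = c" "c < inp 2" "left inp c = u"
  shows "searching U u (Suc c) (run try_edge s)"
proof -
  let ?s = "run (Assign ''p'' (Const 0) (Read ''budget'' (reg ''c''))) s"
  define t where "t = run try_price ?s"
  have R: "ready s" and su: "s ''u'' 0 = u" "s ''limit'' 0 = lim u" and
    B: "best_trial U (s ''val'') (s ''occ'') u c (s ''choice'') (s ''bval'') (s ''bocc'') (s ''best'' 0)"
    using S by (auto simp: searching_def)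
  have p: "?s ''p'' 0 = scaled inp c" using R c by (simp add: ready_def)
  have Rs: "ready ?s" using R by (simp add: ready_def)
  have "trying U (?s ''p'' 0) (inp 2) t"
    using B su u unfolding t_def by (intro run_try_price[OF Rs]) (simp_all add: best_trial_def)
  moreover have fr: "t y = s y"
    if "y \<notin> {''i'', ''f'', ''g'', ''bi'', ''bf'', ''gain'', ''used'', ''tval'', ''tocc'', ''r'', ''p''}" for y
    using run_frame[of y try_price ?s] that by (simp add: t_def)
  ultimately have T: "trial u (scaled inp c) (s ''val'') (s ''occ'') (inp 2) (t ''tval'') (t ''tocc'')
      (t ''used'') (t ''gain'' 0)" and Rt: "ready t"
    unfolding p trying_def using su by (simp_all add: fr del: run.simps)
  have run: "run try_edge s = run (Branch (Sub (reg ''gain'') (reg ''best''))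
       (Assign ''best'' (Const 0) (reg ''gain'') ;;
        Assign ''choice'' (reg ''u'') (Add (reg ''c'') (Const 1)) ;;
        Loop ''f'' 2
         (Assign ''bval'' (reg ''f'') (Read ''tval'' (reg ''f'')) ;;
          Assign ''bocc'' (reg ''f'') (Read ''tocc'' (reg ''f''))))
       Nop) t" by (simp add: try_edge_def t_def)
  show ?thesis
  proof (cases "t ''gain'' 0 \<le> s ''best'' 0")
    case True
    then have "run try_edge s = t" unfolding run by (simp add: fr del: run.simps(2,3,5))
    then show ?thesis
      using best_trial_keep[OF B T True] Rt su by (simp add: searching_def fr del: run.simps)
  next
    case False
    let ?copy = "Assign ''bval'' (reg ''f'') (Read ''tval'' (reg ''f'')) ;;
          Assign ''bocc'' (reg ''f'') (Read ''tocc'' (reg ''f''))"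
    let ?r = "t(''best'' := (s ''best'')(0 := t ''gain'' 0), ''choice'' := (s ''choice'')(u := Suc c))"
    let ?z = "run (Loop ''f'' 2 ?copy) ?r"
    have z: "run try_edge s = ?z"
      unfolding run using False su c by (simp add: fr del: run.simps(5))
    let ?I = "\<lambda>n t. (\<forall>f<n. t ''bval'' f = t ''tval'' f \<and> t ''bocc'' f = t ''tocc'' f)"
    have "?I (inp 2) ?z"
    proof (induction rule: run_Loop_induct[where I = ?I])
      case bound
      show ?case using R by (simp add: fr ready_def del: run.simps)
    next
      case (step f t)
      then show ?case by (simp add: less_Suc_eq)
    qed simp_all
    moreover have zf: "?z y = ?r y" if "y \<notin> {''f'', ''bval'', ''bocc''}" for y
      using run_frame[of y "Loop ''f'' 2 ?copy" ?r] that by simp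
    ultimately have "best_trial U (s ''val'') (s ''occ'') u (Suc c) ((s ''choice'')(u := Suc c))
        (?z ''bval'') (?z ''bocc'') (t ''gain'' 0)"
      using False by (intro best_trial_improve[OF B u c(2,3) T]) (simp_all del: run.simps)
    moreover have "ready ?z" by (rule ready_frame[OF R]) (simp_all add: zf fr del: run.simps)
    ultimately show ?thesis
      unfolding z using su by (simp add: searching_def zf fr del: run.simps)
  qed
qed

end

lemma run_copy_pair:
  assumes "x \<notin> {''f'', ''input'', y, x', y'}" "x' \<notin> {''f'', ''input'', y, y'}" "y \<noteq> ''f''" "y' \<noteq> ''f''"
    "f < s ''input'' 2"
  defines "c \<equiv> Loop ''f'' 2 (Assign x (reg ''f'') (Read y (reg ''f'')) ;;
    Assign x' (reg ''f'') (Read y' (reg ''f'')))"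
  shows "run c s x f = s y f" "run c s x' f = s y' f"
proof -
  let ?I = "\<lambda>n t. (\<forall>f<n. t x f = s y f \<and> t x' f = s y' f) \<and> t y = s y \<and> t y' = s y'"
  have "?I (s ''input'' 2) (run c s)"
    unfolding c_def
  proof (induction rule: run_Loop_induct[where I = ?I])
    case (step i t)
    then show ?case using assms(1-4) by (auto simp: less_Suc_eq)
  qed (use assms in auto)
  then show "run c s x f = s y f" "run c s x' f = s y' f" using assms(5) by auto
qed

context greedy_run
begin

lemma run_serve:
  assumes R: "ready s" and k: "s ''k'' 0 = k" "name inp k = u"
    and lim: "lim u = room (inp 2) (code inp k)" and u: "u \<notin> U"
    and sol: "solution U (s ''choice'') (s ''val'') (s ''occ'')" "competitive U (s ''val'')"
  defines "t \<equiv> run serve s"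
  shows "ready t" "solution (insert u U) (t ''choice'') (t ''val'') (t ''occ'')"
    "competitive (insert u U) (t ''val'')"
proof -
  let ?l = "if code inp k = 0 then inp 2 else code inp k - 1"
  define s1 where "s1 = s(''u'' := (s ''u'')(0 := u), ''limit'' := (s ''limit'')(0 := ?l),
    ''best'' := (s ''best'')(0 := 0), ''choice'' := (s ''choice'')(u := 0))"
  define s2 where "s2 = run (Loop ''f'' 2
       (Assign ''bval'' (reg ''f'') (Read ''val'' (reg ''f'')) ;;
        Assign ''bocc'' (reg ''f'') (Read ''occ'' (reg ''f'')))) s1"
  define s3 where "s3 = run (Loop ''c'' 2 (Branch (neq_exp (left_exp (reg ''c'')) (reg ''u'')) Nop try_edge)) s2"
  have inp: "s ''input'' = inp" using R by (simp add: ready_def)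
  have t: "t = run (Loop ''f'' 2
       (Assign ''val'' (reg ''f'') (Read ''bval'' (reg ''f'')) ;;
        Assign ''occ'' (reg ''f'') (Read ''bocc'' (reg ''f'')))) s3"
    using inp k by (cases "code inp k = 0")
      (simp_all add: t_def serve_def s3_def s2_def s1_def del: run.simps(5))
  have f2: "s2 y = s1 y" if "y \<notin> {''f'', ''bval'', ''bocc''}" for y
    unfolding s2_def by (rule run_frame) (use that in simp)
  have f3: "s3 y = s2 y" if "y \<notin> insert ''c'' (writes try_edge)" for y
    unfolding s3_def by (rule run_frame) (use that in simp)
  have ft: "t y = s3 y" if "y \<notin> {''f'', ''val'', ''occ''}" for y
    unfolding t by (rule run_frame) (use that in simp)
  have copy: "s2 ''bval'' f = s2 ''val'' f" "s2 ''bocc'' f = s2 ''occ'' f" if "f < inp 2" for f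
  proof -
    have "f < s1 ''input'' 2" using that inp by (simp add: s1_def)
    from run_copy_pair[of "''bval''" "''val''" "''bocc''" "''occ''" f s1, OF _ _ _ _ this, folded s2_def]
    show "s2 ''bval'' f = s2 ''val'' f" "s2 ''bocc'' f = s2 ''occ'' f" by (simp_all add: f2)
  qed
  have R2: "ready s2" by (rule ready_frame[OF R]) (simp_all add: f2, simp_all add: s1_def)
  have sol2: "solution U (s2 ''choice'') (s2 ''val'') (s2 ''occ'')"
    using solution_change[OF sol(1) u] by (simp add: f2) (simp add: s1_def)
  have "best_trial U (s2 ''val'') (s2 ''occ'') u 0 (s2 ''choice'') (s2 ''bval'') (s2 ''bocc'') 0"
    by (rule best_trial_init[OF sol2 u _ copy]) (simp_all add: f2, simp add: s1_def)
  then have start: "searching U u 0 s2"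
    using R2 lim by (simp add: searching_def f2) (simp add: s1_def room_def)
  have "searching U u (inp 2) s3"
    unfolding s3_def
  proof (induction rule: run_Loop_induct[where I = "searching U u"])
    case init
    show ?case using start by (simp add: searching_def ready_def)
  next
    case (step c t)
    have eq: "t ''input'' = inp" "t ''u'' 0 = u" using step(2) by (auto simp: searching_def ready_def)
    show ?case
    proof (cases "left inp c = u")
      case True
      have "searching U u (Suc c) (run try_edge t)" using step(1-3) u True by (intro run_try_edge)
      then show ?thesis using True eq step(3) by (simp add: searching_def ready_def)
    next
      case False
      then have "best_trial U (t ''val'') (t ''occ'') u (Suc c) (t ''choice'') (t ''bval'')
          (t ''bocc'') (t ''best'' 0)"
        using step(2) by (intro best_trial_skip) (simp_all add: searching_def)
      then show ?thesis using False eq step(2,3) by (simp add: searching_def ready_def)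
    qed
  qed (use f2[of "''input''"] inp in \<open>auto simp: s1_def\<close>)
  then have R3: "ready s3"
    and B: "best_trial U (s3 ''val'') (s3 ''occ'') u (inp 2) (s3 ''choice'') (s3 ''bval'')
      (s3 ''bocc'') (s3 ''best'' 0)"
    by (simp_all add: searching_def)
  show "ready t" by (rule ready_frame[OF R3]) (simp_all add: ft)
  have copy3: "t ''val'' f = s3 ''bval'' f" "t ''occ'' f = s3 ''bocc'' f" if "f < inp 2" for f
    using that run_copy_pair[of "''val''" "''bval''" "''occ''" "''bocc''" f s3] R3
    by (simp_all add: t ready_def)
  have "solution (insert u U) (t ''choice'') (t ''val'') (t ''occ'') \<longleftrightarrow>
      solution (insert u U) (s3 ''choice'') (s3 ''bval'') (s3 ''bocc'')"
    using solution_cong[OF copy3] by (simp add: ft)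
  with B show "solution (insert u U) (t ''choice'') (t ''val'') (t ''occ'')"
    by (simp add: best_trial_def)
  have "competitive U (s3 ''val'')" using sol(2) by (simp add: f3 f2) (simp add: s1_def)
  then have "competitive (insert u U) (s3 ''bval'')" by (rule best_trial_competitive[OF B u])
  then show "competitive (insert u U) (t ''val'')" by (rule competitive_cong) (simp add: copy3)
qed

text \<open>With no vertex served, zero arrays satisfy both invariants trivially. Distinct names
  ensure that no vertex is served twice, which gives the premise \<open>u \<notin> U\<close> of
  \<open>run_serve\<close>.\<close>

lemma run_greedy:
  assumes R: "ready s" and zero: "s ''val'' = (\<lambda>_. 0)" "s ''occ'' = (\<lambda>_. 0)"
    and inj: "inj_on (name inp) {..<inp 0}"
    and lim: "\<And>k. k < inp 0 \<Longrightarrow> lim (name inp k) = room (inp 2) (code inp k)"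
  defines "t \<equiv> run greedy s" and "U \<equiv> name inp ` {..<inp 0}"
  shows "solution U (t ''choice'') (t ''val'') (t ''occ'')" "competitive U (t ''val'')"
proof -
  let ?I = "\<lambda>k t. ready t \<and> solution (name inp ` {..<k}) (t ''choice'') (t ''val'') (t ''occ'') \<and>
    competitive (name inp ` {..<k}) (t ''val'')"
  have "?I (inp 0) t"
    unfolding t_def greedy_def
  proof (induction rule: run_Loop_induct[where I = ?I])
    case (step k t)
    have "name inp k \<notin> name inp ` {..<k}"
    proof
      assume "name inp k \<in> name inp ` {..<k}"
      then obtain k' where "k' < k" "name inp k' = name inp k" by auto
      with inj_onD[OF inj, of k' k] step(1) show False by auto
    qed
    note serve = run_serve[of t k "name inp k" "name inp ` {..<k}", OF _ step(3) refl lim[OF step(1)] this]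
    have "ready (run serve t)"
      "solution (name inp ` {..<Suc k}) (run serve t ''choice'') (run serve t ''val'') (run serve t ''occ'')"
      "competitive (name inp ` {..<Suc k}) (run serve t ''val'')"
      using step(2) serve by (simp_all add: lessThan_Suc)
    then show ?case by (simp add: ready_def)
  next
    case init
    have "competitive {} (s ''val'')" "solution {} (s ''choice'') (s ''val'') (s ''occ'')"
      using zero by (simp_all add: competitive_def solution_def)
    then show ?case using R by (simp add: ready_def)
  qed (use R in \<open>simp_all add: ready_def\<close>)
  then show "solution U (t ''choice'') (t ''val'') (t ''occ'')" "competitive U (t ''val'')"
    by (simp_all add: U_def)
qed

end

section \<open>Writing the output\<close>

lemma run_write_prices:
  assumes "s ''input'' = inp"
  defines "out \<equiv> run write_prices s ''output''"
  shows "k < inp 0 \<Longrightarrow> s ''choice'' (name inp k) = 0 \<Longrightarrow> out (2 * k) = 0 \<and> out (2 * k + 1) = 1"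
    and "k < inp 0 \<Longrightarrow> s ''choice'' (name inp k) = Suc c \<Longrightarrow>
      out (2 * k) = num inp c \<and> out (2 * k + 1) = den inp c"
    and "k < inp 1 \<Longrightarrow> out (2 * (inp 0 + k)) = 0 \<and> out (2 * (inp 0 + k) + 1) = 1"
proof -
  let ?P = "\<lambda>c out k. if c = 0 then out (2 * k) = 0 \<and> out (2 * k + 1) = (1 :: nat)
    else out (2 * k) = num inp (c - 1) \<and> out (2 * k + 1) = den inp (c - 1)"
  let ?I = "\<lambda>n t. t ''input'' = inp \<and> t ''choice'' = s ''choice'' \<and>
    (\<forall>k<n. ?P (s ''choice'' (name inp k)) (t ''output'') k)"
  define s1 where "s1 = run (Loop ''k'' 0
       (Branch (Read ''choice'' (name_exp (reg ''k'')))
         (Assign ''output'' (Mul (reg ''k'') (Const 2))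
            (num_exp (Sub (Read ''choice'' (name_exp (reg ''k''))) (Const 1))) ;;
          Assign ''output'' (Add (Mul (reg ''k'') (Const 2)) (Const 1))
            (den_exp (Sub (Read ''choice'' (name_exp (reg ''k''))) (Const 1))))
         (Assign ''output'' (Mul (reg ''k'') (Const 2)) (Const 0) ;;
          Assign ''output'' (Add (Mul (reg ''k'') (Const 2)) (Const 1)) (Const 1)))) s"
  have 1: "?I (inp 0) s1"
    unfolding s1_def
  proof (induction rule: run_Loop_induct[where I = ?I])
    case (step k t)
    \<comment> \<open>Numerators sit in even and denominators in odd cells, so neither kind
      overwrites the other.\<close>
    have ne: "k * 2 \<noteq> Suc (k' * 2)" "Suc (k * 2) \<noteq> k' * 2" for k k' :: nat by presburger+
    from step(1-3) ne show ?case
      by (auto simp: less_Suc_eq mult.commute[of 2] split: if_splits)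
  qed (use assms in simp_all)
  let ?J = "\<lambda>n t. t ''input'' = inp \<and> (\<forall>k<inp 0. ?P (s ''choice'' (name inp k)) (t ''output'') k) \<and>
    (\<forall>k<n. t ''output'' (2 * (inp 0 + k)) = 0 \<and> t ''output'' (2 * (inp 0 + k) + 1) = 1)"
  have "?J (inp 1) (run (Loop ''k'' 1
       (Assign ''output'' (Mul (Add (size_exp 0) (reg ''k'')) (Const 2)) (Const 0) ;;
        Assign ''output'' (Add (Mul (Add (size_exp 0) (reg ''k'')) (Const 2)) (Const 1)) (Const 1))) s1)"
  proof (induction rule: run_Loop_induct[where I = ?J])
    case (step k t)
    have ne: "k * 2 \<noteq> Suc (k' * 2)" "Suc (k * 2) \<noteq> k' * 2" for k k' :: nat by presburger+
    from step(1-3) ne show ?case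
      by (auto simp: less_Suc_eq mult.commute[of 2] split: if_splits)
  qed (use 1 in \<open>auto split: if_splits\<close>)
  then have J: "?J (inp 1) (run write_prices s)" unfolding write_prices_def run.simps(3) s1_def .
  show "k < inp 0 \<Longrightarrow> s ''choice'' (name inp k) = 0 \<Longrightarrow> out (2 * k) = 0 \<and> out (2 * k + 1) = 1"
    and "k < inp 0 \<Longrightarrow> s ''choice'' (name inp k) = Suc c \<Longrightarrow>
      out (2 * k) = num inp c \<and> out (2 * k + 1) = den inp c"
    and "k < inp 1 \<Longrightarrow> out (2 * (inp 0 + k)) = 0 \<and> out (2 * (inp 0 + k) + 1) = 1"
    using J by (auto simp: out_def)
qed

lemma run_write_edges:
  assumes "s ''input'' = inp"
  defines "t \<equiv> run write_edges s" and "n \<equiv> 2 * (inp 0 + inp 1)"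
  shows "t ''output_length'' 0 = n + inp 2"
    and "j < n \<Longrightarrow> t ''output'' j = s ''output'' j"
    and "i < inp 2 \<Longrightarrow> t ''output'' (n + i) = (if \<exists>f<inp 2. s ''occ'' f = Suc i then 1 else 0)"
proof -
  define s1 where "s1 = run (Loop ''i'' 2
       (Assign ''output'' (Add (Mul (Add (size_exp 0) (size_exp 1)) (Const 2)) (reg ''i'')) (Const 0))) s"
  let ?I = "\<lambda>k t. t ''input'' = inp \<and> t ''occ'' = s ''occ'' \<and> (\<forall>j<n. t ''output'' j = s ''output'' j) \<and>
    (\<forall>i<k. t ''output'' (n + i) = 0)"
  have 1: "?I (inp 2) s1"
    unfolding s1_def
  proof (induction rule: run_Loop_induct[where I = ?I])
    case (step k t)
    then show ?case by (simp add: less_Suc_eq n_def mult.commute)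
  qed (use assms in simp_all)
  let ?J = "\<lambda>k t. t ''input'' = inp \<and> t ''occ'' = s ''occ'' \<and> (\<forall>j<n. t ''output'' j = s ''output'' j) \<and>
    (\<forall>i<inp 2. t ''output'' (n + i) = (if \<exists>f<k. s ''occ'' f = Suc i then 1 else 0))"
  let ?body = "Branch (Read ''occ'' (reg ''f''))
         (Assign ''output''
           (Add (Mul (Add (size_exp 0) (size_exp 1)) (Const 2)) (Sub (Read ''occ'' (reg ''f'')) (Const 1)))
           (Const 1))
         Nop"
  have J: "?J (inp 2) (run (Loop ''f'' 2 ?body) s1)"
  proof (induction rule: run_Loop_induct[where I = ?J])
    case (step k t)
    show ?case
    proof (cases "s ''occ'' k")
      case 0
      then show ?thesis using step(1-3) by (auto simp: less_Suc_eq)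
    next
      case (Suc i)
      then show ?thesis using step(1-3) by (auto simp: less_Suc_eq n_def mult.commute)
    qed
  qed (use 1 in simp_all)
  have t: "t = run (Assign ''output_length'' (Const 0) (Add (Mul (Add (size_exp 0) (size_exp 1)) (Const 2)) (size_exp 2)))
      (run (Loop ''f'' 2 ?body) s1)"
    by (simp add: t_def write_edges_def s1_def)
  show "t ''output_length'' 0 = n + inp 2" "j < n \<Longrightarrow> t ''output'' j = s ''output'' j"
    "i < inp 2 \<Longrightarrow> t ''output'' (n + i) = (if \<exists>f<inp 2. s ''occ'' f = Suc i then 1 else 0)"
    using J unfolding t by (simp_all add: n_def del: run.simps(5))
qed


section \<open>Encoded instances\<close>

lemma nth_concat_uniform:
  assumes "\<And>x. x \<in> set xs \<Longrightarrow> length (f x) = d"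
  shows "length (concat (map f xs)) = d * length xs"
    and "k < length xs \<Longrightarrow> j < d \<Longrightarrow> concat (map f xs) ! (d * k + j) = f (xs ! k) ! j"
proof -
  show len: "length (concat (map f xs)) = d * length xs"
    using assms by (induction xs) auto
  show "concat (map f xs) ! (d * k + j) = f (xs ! k) ! j" if "k < length xs" "j < d"
    using that assms
  proof (induction xs arbitrary: k)
    case (Cons x xs)
    then have x: "length (f x) = d" by simp
    show ?case
    proof (cases k)
      case 0
      then show ?thesis using x Cons.prems(2) by (simp add: nth_append)
    next
      case (Suc k')
      have "concat (map f xs) ! (d * k' + j) = f (xs ! k') ! j"
        using Cons.prems Suc by (intro Cons.IH) auto
      then show ?thesis using x Suc by (simp add: nth_append)
    qed
  qed simp
qed

lemma concat_pairs:
  assumes "\<And>k. k < length ws \<Longrightarrow> g (ws ! k) = [out (2 * k), out (2 * k + 1)]"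
  shows "concat (map g ws) = map out [0..<2 * length ws]"
  using assms
proof (induction ws rule: rev_induct)
  case (snoc w ws)
  have "concat (map g ws) = map out [0..<2 * length ws]"
  proof (rule snoc.IH)
    fix k
    assume "k < length ws"
    then show "g (ws ! k) = [out (2 * k), out (2 * k + 1)]"
      using snoc.prems[of k] by (simp add: nth_append)
  qed
  moreover have "g w = [out (2 * length ws), out (2 * length ws + 1)]"
    using snoc.prems[of "length ws"] by simp
  ultimately show ?case by simp
qed simp

lemma encode_rat_nonneg:
  assumes "0 \<le> r"
  obtains a b where "encode_rat r = [a, b]" "0 < b" "r = of_nat a / of_nat b"
proof -
  obtain a b where q: "quotient_of r = (a, b)" by fastforce
  then have b: "b > 0" and r: "r = of_int a / of_int b"
    using quotient_of_denom_pos quotient_of_div by blast+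
  have a: "a \<ge> 0" using assms b unfolding r by (simp add: zero_le_divide_iff)
  show ?thesis
  proof (rule that)
    show "encode_rat r = [nat a, nat b]" by (simp add: encode_rat_def q)
    show "0 < nat b" using b by simp
    show "r = of_nat (nat a) / of_nat (nat b)" using a b r by simp
  qed
qed

lemma encode_rat_0: "encode_rat 0 = [0, 1]"
  by (simp add: encode_rat_def)

locale encoded_instance =
  fixes I :: "(nat, nat) pricing" and ls rs es :: "nat list"
  assumes inst: "pricing_instance I" and lists: "lists_instance I ls rs es"
begin

abbreviation "xs \<equiv> encode_instance I ls rs es"
abbreviation "start \<equiv> initial_state xs"

section \<open>Reading the encoded instance\<close>

definition inp :: "nat \<Rightarrow> nat" where "inp = start ''input''"

lemma distinct: "distinct ls" "distinct rs" "distinct es" "set ls \<inter> set rs = {}"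
  and ends: "e \<in> set es \<Longrightarrow> left_end I e \<in> set ls" "e \<in> set es \<Longrightarrow> right_end I e \<in> set rs"
    "e \<in> set es \<Longrightarrow> 0 \<le> budget I e"
  using inst lists unfolding pricing_instance_def lists_instance_def by auto

lemma length_xs: "length xs = 3 + 2 * (length ls + length rs) + 4 * length es"
proof -
  have "length (concat (map (\<lambda>w. [w, encode_capacity (capacity I w)]) (ls @ rs))) =
      2 * length (ls @ rs)"
    by (rule nth_concat_uniform) simp
  moreover have "length (concat (map (\<lambda>e. [left_end I e, right_end I e] @ encode_rat (budget I e)) es)) =
      4 * length es"
    by (rule nth_concat_uniform) (simp add: encode_rat_def)
  ultimately show ?thesis unfolding encode_instance_def by simp
qed

lemma inp_sizes [simp]: "inp 0 = length ls" "inp (Suc 0) = length rs" "inp 2 = length es"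
  using length_xs by (simp_all add: inp_def initial_state_def encode_instance_def)

lemma inp_vertex:
  assumes "k < length ls + length rs"
  shows "name inp k = (ls @ rs) ! k" "code inp k = encode_capacity (capacity I ((ls @ rs) ! k))"
proof -
  let ?f = "\<lambda>w. [w, encode_capacity (capacity I w)]"
  have len: "length (concat (map ?f (ls @ rs))) = 2 * length (ls @ rs)"
    by (rule nth_concat_uniform) simp
  have nth: "concat (map ?f (ls @ rs)) ! (2 * k + j) = ?f ((ls @ rs) ! k) ! j" if "j < 2" for j
    using assms that by (intro nth_concat_uniform) auto
  have "inp (2 * k + 3 + j) = concat (map ?f (ls @ rs)) ! (2 * k + j)" if "j < 2" for j
  proof -
    have l: "2 * k + j < length (concat (map ?f (ls @ rs)))" using len assms that by simp
    have "2 * k + 3 + j < length xs" using length_xs assms that by simp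
    then have "inp (2 * k + 3 + j) = xs ! (3 + (2 * k + j))"
      by (simp add: inp_def initial_state_def add.commute add.left_commute)
    also have "xs ! (3 + (2 * k + j)) = concat (map ?f (ls @ rs)) ! (2 * k + j)"
      unfolding encode_instance_def using l by (simp add: nth_append del: map_append concat_append)
    finally show ?thesis .
  qed
  from this[of 0] this[of 1] nth[of 0] nth[of 1]
  show "name inp k = (ls @ rs) ! k" "code inp k = encode_capacity (capacity I ((ls @ rs) ! k))"
    by (simp_all add: name_def code_def numeral_eq_Suc)
qed

lemma inp_edge:
  assumes "i < length es"
  shows "left inp i = left_end I (es ! i)" "right inp i = right_end I (es ! i)"
    "[num inp i, den inp i] = encode_rat (budget I (es ! i))"
proof -
  let ?f = "\<lambda>w. [w, encode_capacity (capacity I w)]"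
  let ?g = "\<lambda>e. [left_end I e, right_end I e] @ encode_rat (budget I e)"
  let ?vs = "[length ls, length rs, length es] @ concat (map ?f (ls @ rs))"
  have lenf: "length (concat (map ?f (ls @ rs))) = 2 * length (ls @ rs)"
    by (rule nth_concat_uniform) simp
  have nth: "concat (map ?g es) ! (4 * i + j) = ?g (es ! i) ! j" if "j < 4" for j
    using assms that by (intro nth_concat_uniform) (auto simp: encode_rat_def)
  have "edge_field j inp i = ?g (es ! i) ! j" if "j < 4" for j
  proof -
    let ?n = "2 * (length ls + length rs) + 4 * i + (3 + j)"
    have "?n < length xs" using length_xs assms that by simp
    then have "edge_field j inp i = xs ! ?n"
      by (simp add: edge_field_def) (simp add: inp_def initial_state_def)
    also have "?n = length ?vs + (4 * i + j)" using lenf by simp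
    also have "xs ! \<dots> = concat (map ?g es) ! (4 * i + j)"
      unfolding encode_instance_def append_assoc[symmetric] by (rule nth_append_length_plus)
    finally show ?thesis using nth[OF that] by simp
  qed
  from this[of 0] this[of 1] this[of 2] this[of 3]
  show "left inp i = left_end I (es ! i)" "right inp i = right_end I (es ! i)"
    "[num inp i, den inp i] = encode_rat (budget I (es ! i))"
    by (simp_all add: encode_rat_def numeral_eq_Suc)
qed

lemma den_pos: "i < length es \<Longrightarrow> 0 < den inp i"
  and budget_eq: "i < length es \<Longrightarrow> budget I (es ! i) = of_nat (num inp i) / of_nat (den inp i)"
proof -
  assume i: "i < length es"
  obtain a b where "encode_rat (budget I (es ! i)) = [a, b]" "0 < b"
    "budget I (es ! i) = of_nat a / of_nat b"
    using encode_rat_nonneg ends(3)[of "es ! i"] i by (metis nth_mem)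
  with inp_edge(3)[OF i] show "0 < den inp i"
    "budget I (es ! i) = of_nat (num inp i) / of_nat (den inp i)" by auto
qed

definition scale :: nat where "scale = (\<Prod>j<length es. den inp j)"

lemma scale_pos: "0 < scale"
  unfolding scale_def using den_pos by (intro prod_pos) auto

text \<open>\<open>scaled\<close> leaves out the denominator of \<open>i\<close> itself, and exactly
  this factor of \<open>scale\<close> cancels against the budget.\<close>

lemma scaled_eq:
  assumes "i < length es"
  shows "real (scaled inp i) = of_rat (budget I (es ! i)) * real scale"
proof -
  have "scale = den inp i * (\<Prod>j\<in>{..<length es} - {i}. den inp j)"
    unfolding scale_def using assms by (simp add: prod.remove[of _ i])
  then show ?thesis
    using den_pos[OF assms] by (simp add: scaled_def budget_eq[OF assms] of_rat_divide)
qed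

definition lim :: "nat \<Rightarrow> nat" where
  "lim w = room (length es) (encode_capacity (capacity I w))"

lemma lim_le_capacity: "enat n \<le> capacity I w" if "n \<le> lim w" "capacity I w \<noteq> \<infinity>"
  using that by (cases "capacity I w") (auto simp: lim_def room_def)

text \<open>The bound by the number of edges compensates for \<open>lim\<close> replacing infinity
  by \<open>length es\<close>.\<close>

lemma le_lim:
  assumes "enat n \<le> capacity I w" "n \<le> length es"
  shows "n \<le> lim w"
  using assms by (cases "capacity I w") (auto simp: lim_def room_def)

lemma enat_le_capacity: "n \<le> lim w \<Longrightarrow> enat n \<le> capacity I w"
  by (cases "capacity I w = \<infinity>") (auto intro: lim_le_capacity)

definition act :: "nat \<Rightarrow> bool" where
  "act f \<longleftrightarrow> run set_slots (run set_capacities start) ''active'' f \<noteq> 0"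

sublocale greedy_run inp act lim .

lemma capacities:
  assumes "v \<in> set rs"
  shows "run set_capacities start ''rem'' v = lim v"
proof -
  obtain k where k: "k < length rs" "v = rs ! k" using assms by (metis in_set_conv_nth)
  have n: "name inp (inp 0 + k) = rs ! k" if "k < length rs" for k
    using that by (simp add: inp_vertex nth_append)
  have "inj_on (\<lambda>k. name inp (inp 0 + k)) {..<inp 1}"
    using distinct(2) n by (auto simp: inj_on_def nth_eq_iff_index_eq)
  from run_set_capacities[of start inp, OF inp_def[symmetric] this] k n[OF k(1)]
  show ?thesis by (simp add: inp_vertex lim_def nth_append)
qed

lemma slots:
  assumes "v \<in> set rs"
  shows "card {f. f < length es \<and> act f \<and> right inp f = v} \<le> lim v"
    and "card {f. f < length es \<and> act f \<and> right inp f = v} = lim v \<or>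
      (\<forall>f<length es. right inp f = v \<longrightarrow> act f)"
proof -
  let ?s = "run set_capacities start"
  have "?s ''input'' = inp" by (simp add: run_frame inp_def)
  from run_set_slots[of ?s inp v, OF this]
  show "card {f. f < length es \<and> act f \<and> right inp f = v} \<le> lim v"
    "card {f. f < length es \<and> act f \<and> right inp f = v} = lim v \<or>
      (\<forall>f<length es. right inp f = v \<longrightarrow> act f)"
    by (simp_all add: act_def capacities[OF assms])
qed

definition final :: state where
  "final = run greedy (run set_budgets (run set_slots (run set_capacities start)))"

abbreviation "ch \<equiv> final ''choice''"
abbreviation "val \<equiv> final ''val''"
abbreviation "occ \<equiv> final ''occ''"

lemma final: "solution (set ls) ch val occ" "competitive (set ls) val"
proof -
  let ?s = "run set_budgets (run set_slots (run set_capacities start))"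
  have "ready ?s"
    unfolding ready_def
    using run_set_budgets[of "run set_slots (run set_capacities start)" inp]
    by (simp add: run_frame inp_def act_def)
  moreover have "?s ''val'' = (\<lambda>_. 0)" "?s ''occ'' = (\<lambda>_. 0)"
    by (simp_all add: run_frame initial_state_def)
  moreover have n: "name inp k = ls ! k" if "k < length ls" for k
    using that by (simp add: inp_vertex nth_append)
  moreover have "inj_on (name inp) {..<inp 0}"
    using distinct(1) n by (auto simp: inj_on_def nth_eq_iff_index_eq)
  moreover have "lim (name inp k) = room (inp 2) (code inp k)" if "k < inp 0" for k
    using that by (simp add: inp_vertex lim_def)
  moreover have "name inp ` {..<inp 0} = set ls"
    using n by (auto simp: in_set_conv_nth image_iff)
  ultimately show "solution (set ls) ch val occ" "competitive (set ls) val"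
    using run_greedy[of ?s] unfolding final_def by metis+
qed

lemma final_solution:
  "f < length es \<Longrightarrow> occ f = 0 \<Longrightarrow> val f = 0"
  "f < length es \<Longrightarrow> occ f = Suc i \<Longrightarrow> i < length es \<and> act f \<and> right inp f = right inp i \<and>
     ch (left inp i) \<noteq> 0 \<and> val f = scaled inp (ch (left inp i) - 1) \<and> val f \<le> scaled inp i"
  "inj_on occ {f. f < length es \<and> occ f \<noteq> 0}"
  "w \<in> set ls \<Longrightarrow> card {f. f < length es \<and> occ f \<noteq> 0 \<and> left inp (occ f - 1) = w} \<le> lim w"
  "w \<in> set ls \<Longrightarrow> ch w \<noteq> 0 \<Longrightarrow> ch w - 1 < length es"
  using final(1) unfolding solution_def unfolding inp_sizes by blast+

section \<open>Feasibility and revenue of the computed solution\<close>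

definition price :: "nat \<Rightarrow> rat" where
  "price w = (if w \<in> set ls \<and> ch w \<noteq> 0 then budget I (es ! (ch w - 1)) else 0)"

definition sold :: "nat set" where
  "sold = (\<lambda>f. es ! (occ f - 1)) ` {f. f < length es \<and> occ f \<noteq> 0}"

lemma occupied:
  assumes "f < length es" "occ f \<noteq> 0"
  shows "occ f - 1 < length es" "act f" "right inp f = right_end I (es ! (occ f - 1))"
    "val f = scaled inp (ch (left_end I (es ! (occ f - 1))) - 1)"
    "ch (left_end I (es ! (occ f - 1))) \<noteq> 0" "val f \<le> scaled inp (occ f - 1)"
proof -
  obtain i where i: "occ f = Suc i" using assms(2) by (cases "occ f") auto
  note final_solution(2)[OF assms(1) i]
  then show "occ f - 1 < length es" "act f" "right inp f = right_end I (es ! (occ f - 1))"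
    "val f = scaled inp (ch (left_end I (es ! (occ f - 1))) - 1)"
    "ch (left_end I (es ! (occ f - 1))) \<noteq> 0" "val f \<le> scaled inp (occ f - 1)"
    using i inp_edge by auto
qed

lemma sold_index:
  assumes "e \<in> sold"
  obtains f where "f < length es" "occ f \<noteq> 0" "e = es ! (occ f - 1)"
  using assms unfolding sold_def by auto

lemma sold_edges: "sold \<subseteq> set es"
  using occupied(1) by (auto simp: sold_def)

lemma price_right: "w \<in> set rs \<Longrightarrow> price w = 0"
  using distinct(4) by (auto simp: price_def)

lemma price_nonneg: "0 \<le> price w"
  using ends(3) final_solution(5) by (auto simp: price_def)

lemma price_scaled:
  assumes "f < length es" "occ f \<noteq> 0"
  shows "of_rat (price (left_end I (es ! (occ f - 1)))) * real scale = real (val f)"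
proof -
  let ?w = "left_end I (es ! (occ f - 1))"
  have "?w \<in> set ls" using ends(1) occupied(1)[OF assms] by simp
  moreover note c = occupied(4,5)[OF assms]
  ultimately have "price ?w = budget I (es ! (ch ?w - 1))" "ch ?w - 1 < length es"
    using final_solution(5) by (auto simp: price_def)
  with c show ?thesis by (simp add: scaled_eq)
qed

lemma sold_budget:
  assumes "e \<in> sold"
  shows "price (left_end I e) \<le> budget I e"
proof -
  obtain f where f: "f < length es" "occ f \<noteq> 0" "e = es ! (occ f - 1)" by (rule sold_index[OF assms])
  have "real (val f) \<le> real (scaled inp (occ f - 1))" using occupied(6)[OF f(1,2)] by simp
  then have "of_rat (price (left_end I e)) * real scale \<le> of_rat (budget I e) * real scale"
    using price_scaled[OF f(1,2)] scaled_eq[OF occupied(1)[OF f(1,2)]] f(3) by simp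
  then show ?thesis using scale_pos by (simp add: of_rat_less_eq)
qed

lemma sold_left:
  assumes "w \<in> set ls"
  shows "card {e \<in> sold. left_end I e = w} \<le> lim w"
proof -
  let ?S = "{f. f < length es \<and> occ f \<noteq> 0 \<and> left inp (occ f - 1) = w}"
  have "{e \<in> sold. left_end I e = w} \<subseteq> (\<lambda>f. es ! (occ f - 1)) ` ?S"
    using inp_edge(1)[OF occupied(1)] by (auto simp: sold_def)
  then have "card {e \<in> sold. left_end I e = w} \<le> card ?S"
    by (rule surj_card_le[rotated]) simp
  also have "\<dots> \<le> lim w" using assms by (rule final_solution(4))
  finally show ?thesis .
qed

text \<open>A sold edge and its slot share their right end, so the edges sold at \<open>w\<close>
  are at most as many as the active slots of \<open>w\<close>.\<close>

lemma sold_right: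
  assumes "w \<in> set rs"
  shows "card {e \<in> sold. right_end I e = w} \<le> lim w"
proof -
  let ?S = "{f. f < length es \<and> act f \<and> right inp f = w}"
  have "{e \<in> sold. right_end I e = w} \<subseteq> (\<lambda>f. es ! (occ f - 1)) ` ?S"
    using occupied(2,3) by (auto simp: sold_def)
  then have "card {e \<in> sold. right_end I e = w} \<le> card ?S"
    by (rule surj_card_le[rotated]) simp
  also have "\<dots> \<le> lim w" by (rule slots(1)[OF assms])
  finally show ?thesis .
qed

lemma vertices: "left_vertices I = set ls" "right_vertices I = set rs" "edges I = set es"
  using lists by (auto simp: lists_instance_def)

lemma feasible_sold: "feasible I (\<lambda>w. of_rat (price w)) sold"
  unfolding feasible_def vertices
proof (intro conjI ballI)
  fix e
  assume e: "e \<in> sold"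
  then have "right_end I e \<in> set rs" using sold_edges ends(2) by auto
  then show "of_rat (price (left_end I e)) + of_rat (price (right_end I e)) \<le> (of_rat (budget I e) :: real)"
    using sold_budget[OF e] by (simp add: price_right of_rat_less_eq)
next
  fix w
  assume w: "w \<in> set ls \<union> set rs"
  have "card {e \<in> sold. left_end I e = w \<or> right_end I e = w} \<le> lim w"
  proof (cases "w \<in> set ls")
    case True
    then have "{e \<in> sold. left_end I e = w \<or> right_end I e = w} = {e \<in> sold. left_end I e = w}"
      using distinct(4) sold_edges ends(2) by blast
    then show ?thesis using sold_left[OF True] by simp
  next
    case False
    then have "{e \<in> sold. left_end I e = w \<or> right_end I e = w} = {e \<in> sold. right_end I e = w}"
      using sold_edges ends(1) by blast
    then show ?thesis using sold_right[of w] w False by simp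
  qed
  then show "enat (card {e \<in> sold. left_end I e = w \<or> right_end I e = w}) \<le> capacity I w"
    by (rule enat_le_capacity)
qed (use sold_edges in \<open>auto simp: price_right price_nonneg\<close>)

text \<open>A sold edge pays the value of its slot, distinct occupied slots hold distinct edges, and
  free slots are worth nothing.\<close>

lemma revenue_sold: "revenue I (\<lambda>w. of_rat (price w)) sold * real scale = real (\<Sum>f<length es. val f)"
proof -
  let ?S = "{f. f < length es \<and> occ f \<noteq> 0}"
  have inj: "inj_on (\<lambda>f. es ! (occ f - 1)) ?S"
  proof (rule inj_onI)
    fix f g
    assume fg: "f \<in> ?S" "g \<in> ?S" "es ! (occ f - 1) = es ! (occ g - 1)"
    have "occ f - 1 < length es" "occ g - 1 < length es" using fg(1,2) occupied(1) by simp_all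
    then have "occ f - 1 = occ g - 1" using fg(3) distinct(3) by (simp add: nth_eq_iff_index_eq)
    moreover have "occ f \<noteq> 0" "occ g \<noteq> 0" using fg(1,2) by simp_all
    ultimately have "occ f = occ g" by linarith
    then show "f = g" using fg(1,2) by (rule inj_onD[OF final_solution(3)])
  qed
  have "revenue I (\<lambda>w. of_rat (price w)) sold = (\<Sum>e\<in>sold. of_rat (price (left_end I e)))"
    unfolding revenue_def using sold_edges ends(2) by (intro sum.cong) (auto simp: price_right subset_iff)
  also have "\<dots> = (\<Sum>f\<in>?S. of_rat (price (left_end I (es ! (occ f - 1)))))"
    by (simp only: sold_def sum.reindex[OF inj] comp_def)
  finally have "revenue I (\<lambda>w. of_rat (price w)) sold * real scale = (\<Sum>f\<in>?S. real (val f))"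
    using price_scaled by (simp add: sum_distrib_right)
  also have "\<dots> = (\<Sum>f<length es. real (val f))"
    using final_solution(1) by (intro sum.mono_neutral_left) auto
  finally show ?thesis by simp
qed

text \<open>The given feasible solution is brought into the form of a \<open>rival\<close>, to which
  \<open>competitive_ratio\<close> applies; its real prices are at most the budgets of the edges
  that \<open>cs\<close> selects.\<close>

lemma approximation:
  assumes "feasible I p' F'"
  shows "revenue I p' F' \<le> 2 * revenue I (\<lambda>w. of_rat (price w)) sold"
proof -
  let ?A = "{i. i < length es \<and> es ! i \<in> F'}"
  have F': "F' \<subseteq> set es" and right0: "\<And>v. v \<in> set rs \<Longrightarrow> p' v = 0"
    and budget: "\<And>e. e \<in> F' \<Longrightarrow> p' (left_end I e) + p' (right_end I e) \<le> of_rat (budget I e)"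
    and cap: "\<And>w. w \<in> set ls \<union> set rs \<Longrightarrow>
      enat (card {e \<in> F'. left_end I e = w \<or> right_end I e = w}) \<le> capacity I w"
    using assms unfolding feasible_def vertices by auto
  have inj_nth: "inj_on ((!) es) X" if "X \<subseteq> {..<length es}" for X
    using that distinct(3) by (auto simp: inj_on_def nth_eq_iff_index_eq subset_iff)
  have A: "bij_betw ((!) es) ?A F'"
    using F' by (auto simp: bij_betw_def in_set_conv_nth subset_iff intro!: inj_nth)
  have card: "card {i \<in> ?A. left inp i = w \<or> right inp i = w} \<le> lim w" if "w \<in> set ls \<union> set rs" for w
  proof (rule le_lim)
    let ?B = "{i \<in> ?A. left inp i = w \<or> right inp i = w}"
    have "(!) es ` ?B \<subseteq> {e \<in> F'. left_end I e = w \<or> right_end I e = w}"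
      by (auto simp: inp_edge)
    moreover have "finite F'" using F' finite_subset by blast
    ultimately have "card ?B \<le> card {e \<in> F'. left_end I e = w \<or> right_end I e = w}"
      by (intro card_inj_on_le[of "(!) es"] inj_nth) auto
    with cap[OF that] show "enat (card ?B) \<le> capacity I w" using enat_ord_simps(1) order_trans by blast
    have "card ?B \<le> card {..<length es}" by (intro card_mono) auto
    then show "card ?B \<le> length es" by simp
  qed
  have mono: "card {i \<in> ?A. P i} \<le> card {i \<in> ?A. Q i}" if "\<And>i. P i \<Longrightarrow> Q i" for P Q
    using that by (intro card_mono) auto
  \<comment> \<open>At each right vertex the rival's edges are injected into the slots: by the
    identity if every edge there is active, and otherwise by counting, since the number of slots is
    then exactly \<open>lim v\<close>.\<close>
  have "\<exists>h. inj_on h {i \<in> ?A. right inp i = v} \<and>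
      h ` {i \<in> ?A. right inp i = v} \<subseteq> {f. f < length es \<and> act f \<and> right inp f = v}"
    if v: "v \<in> set rs" for v
  proof (cases "\<forall>f<length es. right inp f = v \<longrightarrow> act f")
    case True
    then show ?thesis by (intro exI[of _ id]) auto
  next
    case False
    then have "card {f. f < length es \<and> act f \<and> right inp f = v} = lim v" using slots(2)[OF v] by blast
    moreover have "card {i \<in> ?A. right inp i = v} \<le> lim v"
      using card[of v] v mono[of "\<lambda>i. right inp i = v" "\<lambda>i. left inp i = v \<or> right inp i = v"]
      by force
    ultimately show ?thesis by (subst inj_on_iff_card_le) auto
  qed
  then have "\<exists>h. \<forall>v\<in>set rs. inj_on (h v) {i \<in> ?A. right inp i = v} \<and>
      h v ` {i \<in> ?A. right inp i = v} \<subseteq> {f. f < length es \<and> act f \<and> right inp f = v}"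
    by (intro bchoice ballI)
  then obtain h where h: "\<And>v. v \<in> set rs \<Longrightarrow> inj_on (h v) {i \<in> ?A. right inp i = v} \<and>
      h v ` {i \<in> ?A. right inp i = v} \<subseteq> {f. f < length es \<and> act f \<and> right inp f = v}"
    by blast
  define \<sigma> where "\<sigma> i = h (right inp i) i" for i
  have rs: "right inp i \<in> set rs" if "i \<in> ?A" for i using that ends(2) by (simp add: inp_edge)
  have \<sigma>: "\<sigma> i < length es \<and> act (\<sigma> i) \<and> right inp (\<sigma> i) = right inp i" if "i \<in> ?A" for i
    using h[OF rs[OF that]] that unfolding \<sigma>_def by blast
  have inj: "inj_on \<sigma> ?A"
  proof (rule inj_onI)
    fix i j
    assume ij: "i \<in> ?A" "j \<in> ?A" "\<sigma> i = \<sigma> j"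
    have r: "right inp i = right inp j" using \<sigma>[OF ij(1)] \<sigma>[OF ij(2)] ij(3) by simp
    have "inj_on (h (right inp i)) {k \<in> ?A. right inp k = right inp i}" using h rs ij(1) by blast
    moreover have "h (right inp i) i = h (right inp i) j" using ij(3) r by (simp add: \<sigma>_def)
    moreover have "i \<in> {k \<in> ?A. right inp k = right inp i}" "j \<in> {k \<in> ?A. right inp k = right inp i}"
      using ij(1,2) r by simp_all
    ultimately show "i = j" by (rule inj_onD)
  qed
  \<comment> \<open>The witness \<open>c\<close> is a rival edge of least budget at
    \<open>u\<close>. Its budget is tolerated by the other rival edges there, and it is at least the
    rival's price because \<open>c\<close> itself is sold.\<close>
  have "\<exists>c. {i \<in> ?A. left inp i = u} \<noteq> {} \<longrightarrow>
      c \<in> ?A \<and> left inp c = u \<and> (\<forall>i\<in>?A. left inp i = u \<longrightarrow> scaled inp c \<le> scaled inp i)" for u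
  proof (cases "{i \<in> ?A. left inp i = u} = {}")
    case False
    then have "arg_min_on (scaled inp) {i \<in> ?A. left inp i = u} \<in> {i \<in> ?A. left inp i = u}"
      by (intro arg_min_if_finite) auto
    moreover have "scaled inp (arg_min_on (scaled inp) {i \<in> ?A. left inp i = u}) \<le> scaled inp i"
      if "i \<in> ?A" "left inp i = u" for i
      using that by (intro arg_min_least) auto
    ultimately show ?thesis by blast
  qed blast
  then have "\<exists>cs. \<forall>u. {i \<in> ?A. left inp i = u} \<noteq> {} \<longrightarrow>
      cs u \<in> ?A \<and> left inp (cs u) = u \<and> (\<forall>i\<in>?A. left inp i = u \<longrightarrow> scaled inp (cs u) \<le> scaled inp i)"
    by (intro choice allI)
  then obtain cs where cs: "\<And>u. {i \<in> ?A. left inp i = u} \<noteq> {} \<longrightarrow>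
      cs u \<in> ?A \<and> left inp (cs u) = u \<and> (\<forall>i\<in>?A. left inp i = u \<longrightarrow> scaled inp (cs u) \<le> scaled inp i)"
    by blast
  then have cs: "cs (left inp i) \<in> ?A \<and> left inp (cs (left inp i)) = left inp i \<and>
      scaled inp (cs (left inp i)) \<le> scaled inp i" if "i \<in> ?A" for i
    using that by blast
  have ls: "left inp i \<in> set ls" if "i \<in> ?A" for i using that ends(1) by (simp add: inp_edge)
  have "card {i \<in> ?A. left inp i = u} \<le> lim u" for u
  proof (cases "u \<in> set ls")
    case True
    then show ?thesis
      using card[of u] mono[of "\<lambda>i. left inp i = u" "\<lambda>i. left inp i = u \<or> right inp i = u"] by force
  next
    case False
    then have e: "{i \<in> ?A. left inp i = u} = {}" using ls by blast
    show ?thesis unfolding e by simp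
  qed
  then have rival: "rival ?A \<sigma> cs"
    unfolding rival_def using \<sigma> inj cs by auto
  then have ratio: "(\<Sum>i\<in>?A. scaled inp (cs (left inp i))) \<le> 2 * (\<Sum>f<length es. val f)"
    using competitive_ratio[OF final(2) rival ls] by simp
  have "revenue I p' F' * real scale = (\<Sum>i\<in>?A. (p' (left_end I (es ! i)) + p' (right_end I (es ! i))) * real scale)"
    unfolding revenue_def by (simp add: sum.reindex_bij_betw[OF A, symmetric] sum_distrib_right)
  also have "\<dots> \<le> (\<Sum>i\<in>?A. real (scaled inp (cs (left inp i))))"
  proof (rule sum_mono)
    fix i
    assume i: "i \<in> ?A"
    let ?c = "cs (left inp i)"
    have c: "?c < length es" "es ! ?c \<in> F'" "left_end I (es ! ?c) = left_end I (es ! i)"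
      using cs[OF i] i by (auto simp: inp_edge)
    have "p' (left_end I (es ! i)) + p' (right_end I (es ! i)) \<le> of_rat (budget I (es ! ?c))"
      using budget[OF c(2)] c i right0 ends(2) by simp
    then have "(p' (left_end I (es ! i)) + p' (right_end I (es ! i))) * real scale \<le>
        of_rat (budget I (es ! ?c)) * real scale"
      by (intro mult_right_mono) auto
    then show "(p' (left_end I (es ! i)) + p' (right_end I (es ! i))) * real scale \<le> real (scaled inp ?c)"
      using scaled_eq[OF c(1)] by simp
  qed
  also have "\<dots> = real (\<Sum>i\<in>?A. scaled inp (cs (left inp i)))" by simp
  also have "\<dots> \<le> real (2 * (\<Sum>f<length es. val f))" using ratio by (rule of_nat_mono)
  also have "\<dots> = 2 * revenue I (\<lambda>w. of_rat (price w)) sold * real scale"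
    by (simp add: revenue_sold[simplified])
  finally show ?thesis using scale_pos by simp
qed

lemma output_correct: "output_of (run pricing_prog start) = encode_solution ls rs es price sold"
proof -
  define s where "s = run write_prices final"
  define t where "t = run write_edges s"
  let ?n = "2 * (length ls + length rs)"
  have run: "run pricing_prog start = t" by (simp add: pricing_prog_def t_def s_def final_def)
  have fi: "final ''input'' = inp" by (simp add: final_def run_frame inp_def)
  have so: "s ''occ'' = occ" "s ''input'' = inp" using fi by (simp_all add: s_def run_frame)
  note w = run_write_edges[of s inp, OF so(2), folded t_def]
  have e: "t ''output_length'' 0 = ?n + length es" "j < ?n \<Longrightarrow> t ''output'' j = s ''output'' j"
    "i < length es \<Longrightarrow> t ''output'' (?n + i) = (if \<exists>f<length es. occ f = Suc i then 1 else 0)" for i j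
    using w(1) w(2)[of j] w(3)[of i] so by simp_all
  have prices: "encode_rat (price ((ls @ rs) ! k)) = [t ''output'' (2 * k), t ''output'' (2 * k + 1)]"
    if k: "k < length (ls @ rs)" for k
  proof -
    have t: "t ''output'' (2 * k) = s ''output'' (2 * k)" "t ''output'' (2 * k + 1) = s ''output'' (2 * k + 1)"
      using k by (auto intro!: e(2))
    note p = run_write_prices[of final inp, OF fi, folded s_def]
    show ?thesis
    proof (cases "k < length ls")
      case True
      then have w: "(ls @ rs) ! k = name inp k" "name inp k \<in> set ls"
        using inp_vertex(1)[of k] by (simp_all add: nth_append)
      show ?thesis
      proof (cases "ch (name inp k)")
        case 0
        then show ?thesis unfolding t w(1) using p(1)[of k] True by (simp add: price_def encode_rat_0)
      next
        case (Suc c)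
        then have "c < length es" using final_solution(5)[OF w(2)] by simp
        then show ?thesis
          unfolding t w(1) using p(2)[OF _ Suc] True Suc w(2) inp_edge(3)[of c] by (simp add: price_def)
      qed
    next
      case False
      then obtain k' where k': "k = length ls + k'" "k' < length rs"
        using k by (metis add_less_cancel_left le_Suc_ex length_append not_less)
      then have "price ((ls @ rs) ! k) = 0" by (simp add: nth_append price_right)
      then show ?thesis unfolding t using p(3)[of k'] k' by (simp add: encode_rat_0)
    qed
  qed
  have "es ! i \<in> sold \<longleftrightarrow> (\<exists>f<length es. occ f = Suc i)" if i: "i < length es" for i
  proof
    assume "es ! i \<in> sold"
    then obtain f where f: "f < length es" "occ f \<noteq> 0" "es ! i = es ! (occ f - 1)" by (rule sold_index)
    then have "i = occ f - 1"
      using distinct(3) occupied(1)[OF f(1,2)] i by (simp add: nth_eq_iff_index_eq)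
    with f show "\<exists>f<length es. occ f = Suc i" by (intro exI[of _ f]) simp
  qed (force simp: sold_def)
  then have sales: "map (\<lambda>e. if e \<in> sold then 1 else 0) es = map (\<lambda>i. t ''output'' (?n + i)) [0..<length es]"
    by (intro nth_equalityI) (simp_all add: e(3) del: distrib_left_numeral)
  have "output_of t = map (t ''output'') ([0..<?n] @ [?n..<?n + length es])"
    unfolding output_of_def e(1) by (subst upt_add_eq_append) simp_all
  also have "\<dots> = map (t ''output'') [0..<?n] @ map (\<lambda>i. t ''output'' (?n + i)) [0..<length es]"
    by (simp add: map_add_upt[symmetric] add.commute comp_def)
  also have "\<dots> = encode_solution ls rs es price sold"
    using concat_pairs[of "ls @ rs", OF prices] sales by (simp add: encode_solution_def)
  finally show ?thesis using run by simp
qed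

lemma loop_bounds: "3 \<le> length xs" "k < 3 \<Longrightarrow> xs ! k \<le> length xs"
proof -
  show "3 \<le> length xs" by (simp add: length_xs)
  assume "k < 3"
  then consider "k = 0" | "k = 1" | "k = 2" by linarith
  then show "xs ! k \<le> length xs"
    by cases (simp_all add: length_xs, simp_all add: encode_instance_def)
qed

end

theorem theorem2:
  shows "\<exists>c. polynomial_time c instance_encodings \<and> approximation_algorithm 2 c"
proof (intro exI conjI)
  show "polynomial_time (compile pricing_prog) instance_encodings"
    using encoded_instance.loop_bounds
    by (intro polynomial_time_compile tame_pricing_prog)
      (auto simp: instance_encodings_def encoded_instance_def)
  show "approximation_algorithm 2 (compile pricing_prog)"
    unfolding approximation_algorithm_def
  proof (intro allI impI)
    fix I ls rs es
    assume "pricing_instance I \<and> lists_instance I ls rs es"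
    then interpret encoded_instance I ls rs es by unfold_locales auto
    have "computes (compile pricing_prog) xs (encode_solution ls rs es price sold)"
      using compile_correct[OF tame_pricing_prog loop_bounds] output_correct unfolding computes_def by blast
    then show "\<exists>p F. computes (compile pricing_prog) (encode_instance I ls rs es) (encode_solution ls rs es p F) \<and>
      feasible I (\<lambda>w. of_rat (p w)) F \<and>
      (\<forall>p' F'. feasible I p' F' \<longrightarrow> revenue I p' F' \<le> 2 * revenue I (\<lambda>w. of_rat (p w)) F)"
      using feasible_sold approximation by blast
  qed
qed

end
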